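(* Consider the system, assumptions, functions and operators ($\mathbf{f}$, $\mathbf{C}$, $X_0$, $U$, $V$, $\hat{\mathbf{f}}^L$, $\hat{\mathbf{f}}^U$, $B_i^L$, $B_i^U$, $I_c$) described in the context. Let $\mathbf{L}\in\mathbb{R}^{n_x\times n_y}$ be any matrix and let $\mathbf{y}:T\to\mathbb{R}^{n_y}$ be the measured output. Let $\mathbf{x}^L,\mathbf{x}^U:T\to\mathbb{R}^{n_x}$ be absolutely continuous functions such that $[\mathbf{x}^L(t_0),\mathbf{x}^U(t_0)]=X_0$ and, for each $i\in\{1,\dots,n_x\}$ and almost every $t\in T$ (the right-hand sides being defined), $$\dot{x}_i^L(t)=\hat f_i^L\big([t,t],U(t),I_c(B_i^L(\mathbf{x}^L(t),\mathbf{x}^U(t)),t,\mathbf{y}(t)),V(t);\mathbf{L}\big)+(\mathbf{L}\mathbf{y}(t))_i,$$ $$\dot{x}_i^U(t)=\hat f_i^U\big([t,t],U(t),I_c(B_i^U(\mathbf{x}^L(t),\mathbf{x}^U(t)),t,\mathbf{y}(t)),V(t);\mathbf{L}\big)+(\mathbf{L}\mathbf{y}(t))_i.$$ Then $\mathbf{x}(t)\in[\mathbf{x}^L(t),\mathbf{x}^U(t)]$ for all $t\in T$, for every state trajectory $\mathbf{x}$ of the system that is consistent with the measurements $\mathbf{y}$; that is, for every absolutely continuous $\mathbf{x}:T\to D_x$ for which there exist measurable $\mathbf{u}$ and $\mathbf{v}$ with $\mathbf{u}(t)\in U(t)$ and $\mathbf{v}(t)\in V(t)$ for all $t\in T$,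 such that $\mathbf{x}(t_0)\in X_0$, $\dot{\mathbf{x}}(t)=\mathbf{f}(t,\mathbf{u}(t),\mathbf{x}(t))$ for a.e. $t\in T$, and $\mathbf{y}(t)=\mathbf{C}\mathbf{x}(t)+\mathbf{v}(t)$ for all $t\in T$.
   Context: Notation. Inequalities between vectors are componentwise. For $\mathbf{v}\le\mathbf{w}$ in $\mathbb{R}^n$, $[\mathbf{v},\mathbf{w}]=\{\mathbf{z}:\mathbf{v}\le\mathbf{z}\le\mathbf{w}\}$. For $Y\subset\mathbb{R}^n$, $\mathbb{I}Y$ denotes the set of nonempty (compact) intervals $[\mathbf{v},\mathbf{w}]$ contained in $Y$. System. Let $n_x,n_y,n_u$ be positive integers, $T=[t_0,t_f]\subset\mathbb{R}$ a nonempty interval, $D_x\subset\mathbb{R}^{n_x}$, $D_u\subset\mathbb{R}^{n_u}$, $\mathbf{f}:T\times D_u\times D_x\to\mathbb{R}^{n_x}$, and $\mathbf{C}\in\mathbb{R}^{n_y\times n_x}$. The system is $\dot{\mathbf{x}}(t)=\mathbf{f}(t,\mathbf{u}(t),\mathbf{x}(t))$ for a.e. $t\in T$, with measurements $\mathbf{y}(t)=\mathbf{C}\mathbf{x}(t)+\mathbf{v}(t)$ for all $t\in T$. Only absolutely continuous solutions $\mathbf{x}$ are considered. It is assumed that $\mathbf{x}(t_0)\in X_0\in\mathbb{I}D_x$; $\mathbf{v}$ is measurable with $\mathbf{v}(t)\in V(t)=[\mathbf{v}^L(t),\mathbf{v}^U(t)]\in\mathbb{I}\mathbb{R}^{n_y}$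 for all $t\in T$; $\mathbf{u}$ is measurable with $\mathbf{u}(t)\in U(t)=[\mathbf{u}^L(t),\mathbf{u}^U(t)]\in\mathbb{I}D_u$ for all $t\in T$; and there are compact sets $K_v,K_u$ with $V(t)\subset K_v$ and $U(t)\subset K_u$ for all $t\in T$. Lipschitz assumption on $\mathbf{f}$. For any $\mathbf{z}\in D_x$ there exist an open ball $N(\mathbf{z})$ centered at $\mathbf{z}$ and $\alpha\in L^1(T)$ such that for almost every $t\in T$ and every $\mathbf{w}\in U(t)$, $\|\mathbf{f}(t,\mathbf{w},\mathbf{z}_1)-\mathbf{f}(t,\mathbf{w},\mathbf{z}_2)\|\le\alpha(t)\|\mathbf{z}_1-\mathbf{z}_2\|$ for all $\mathbf{z}_1,\mathbf{z}_2\in N(\mathbf{z})\cap D_x$. Inclusion functions. For $\mathbf{L}\in\mathbb{R}^{n_x\times n_y}$ define $\hat{\mathbf{f}}(t,\mathbf{u},\mathbf{z},\mathbf{v};\mathbf{L})=\mathbf{f}(t,\mathbf{u},\mathbf{z})-\mathbf{L}\mathbf{C}\mathbf{z}-\mathbf{L}\mathbf{v}$. The functions $\hat{\mathbf{f}}^L,\hat{\mathbf{f}}^U$ are the lower and upper endpoints of an inclusion monotonic interval extension of $\hat{\mathbf{f}}(\cdot,\cdot,\cdot,\cdot;\mathbf{L})$, i.e. of an interval-valued function of interval arguments (in $\mathbb{I}T\times\mathbb{I}D_u\times\mathbb{I}D_x\times\mathbb{I}\mathbb{R}^{n_y}$) that agrees with $\hat{\mathbf{f}}$ on degenerate (one-point)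 intervals and is monotone with respect to set inclusion. In particular, it is an inclusion function: $\hat{\mathbf{f}}^L([t,t],U',Z',V';\mathbf{L})\le\hat{\mathbf{f}}(t,\mathbf{u},\mathbf{z},\mathbf{v};\mathbf{L})\le\hat{\mathbf{f}}^U([t,t],U',Z',V';\mathbf{L})$ for all $U'\in\mathbb{I}D_u$, $Z'\in\mathbb{I}D_x$, $V'\in\mathbb{I}\mathbb{R}^{n_y}$ and $(t,\mathbf{u},\mathbf{z},\mathbf{v})\in T\times U'\times Z'\times V'$. The subscript $i$ denotes the $i$-th component. Faces. For $i\in\{1,\dots,n_x\}$ and $\mathbf{v},\mathbf{w}\in\mathbb{R}^{n_x}$ (not necessarily $\mathbf{v}\le\mathbf{w}$), put $\hat v_j=\min\{v_j,(v_j+w_j)/2\}$, $\hat w_j=\max\{w_j,(v_j+w_j)/2\}$, and $B_i^L(\mathbf{v},\mathbf{w})=\{\mathbf{z}\in[\hat{\mathbf{v}},\hat{\mathbf{w}}]:z_i=\hat v_i\}$, $B_i^U(\mathbf{v},\mathbf{w})=\{\mathbf{z}\in[\hat{\mathbf{v}},\hat{\mathbf{w}}]:z_i=\hat w_i\}$. Interval tightening. For $\mathbf{M}=[m_{i,j}]\in\mathbb{R}^{n_m\times n}$, $\mathbf{d}\in\mathbb{R}^{n_m}$ and $\mathbf{v}\le\mathbf{w}$ in $\mathbb{R}^n$, the interval $I_t([\mathbf{v},\mathbf{w}],\mathbf{d};\mathbf{M})$ is the output $[\hat{\mathbf{v}},\hat{\mathbf{w}}]$ of the following procedure. Initialize $(\hat{\mathbf{v}},\hat{\mathbf{w}})\leftarrow(\mathbf{v},\mathbf{w})$.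 For $i=1,\dots,n_m$ (outer loop) and $j=1,\dots,n$ (inner loop), in order: if $m_{i,j}\ne0$, set $$\gamma\leftarrow\mathrm{median}\Big\{\hat v_j,\ \hat w_j,\ \tfrac{1}{m_{i,j}}\Big(d_i+\sum_{k\ne j}\max\{-m_{i,k}\hat v_k,-m_{i,k}\hat w_k\}\Big)\Big\}$$ (the middle value of the three numbers); then if $m_{i,j}>0$ set $\hat w_j\leftarrow\gamma$, and if $m_{i,j}<0$ set $\hat v_j\leftarrow\gamma$. Tightening with measurements. Define $I_c([\mathbf{v},\mathbf{w}],t,\mathbf{y})=I_t([\mathbf{v},\mathbf{w}],\mathbf{d}(t,\mathbf{y});\mathbf{M})$ with $\mathbf{d}(t,\mathbf{y})=\begin{bmatrix}\mathbf{y}-\mathbf{v}^L(t)\\-\mathbf{y}+\mathbf{v}^U(t)\end{bmatrix}$ and $\mathbf{M}=\begin{bmatrix}\mathbf{C}\\-\mathbf{C}\end{bmatrix}$. *)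

theory Defs
  imports "HOL-Analysis.Analysis"
begin

definition compact_intervals :: "'a::order set \<Rightarrow> 'a set set"
  where "compact_intervals Y = {{v..w} | v w. v \<le> w \<and> {v..w} \<subseteq> Y}"

definition absolutely_continuous_on :: "real set \<Rightarrow> (real \<Rightarrow> 'a::real_normed_vector) \<Rightarrow> bool"
  where "absolutely_continuous_on S g \<longleftrightarrow>
    (\<forall>\<epsilon>>0. \<exists>\<delta>>0. \<forall>\<D>. \<D> division_of \<Union>\<D> \<and> \<Union>\<D> \<subseteq> S \<and> (\<Sum>K\<in>\<D>. Sup K - Inf K) < \<delta>
        \<longrightarrow> (\<Sum>K\<in>\<D>. norm (g (Sup K) - g (Inf K))) < \<epsilon>)"

definition locally_Lipschitz_L1 ::
  "real set \<Rightarrow> (real \<Rightarrow> 'u set) \<Rightarrow> 'x::euclidean_space set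
    \<Rightarrow> (real \<Rightarrow> 'u \<Rightarrow> 'x \<Rightarrow> 'x) \<Rightarrow> bool"
  where "locally_Lipschitz_L1 T U Dx f \<longleftrightarrow>
    (\<forall>z\<in>Dx. \<exists>r>0. \<exists>\<alpha>. integrable (lebesgue_on T) \<alpha> \<and>
      (AE t in lebesgue_on T. \<forall>w\<in>U t. \<forall>z1\<in>ball z r \<inter> Dx. \<forall>z2\<in>ball z r \<inter> Dx.
        norm (f t w z1 - f t w z2) \<le> \<alpha> t * norm (z1 - z2)))"

definition fhat ::
  "(real \<Rightarrow> real^'p \<Rightarrow> real^'n \<Rightarrow> real^'n) \<Rightarrow> real^'n^'m \<Rightarrow> real^'m^'n
    \<Rightarrow> real \<Rightarrow> real^'p \<Rightarrow> real^'n \<Rightarrow> real^'m \<Rightarrow> real^'n"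
  where "fhat f C L t u z v = f t u z - (L ** C) *v z - L *v v"

definition inclusion_monotonic_extension ::
  "'t::order set \<Rightarrow> 'u::order set \<Rightarrow> 'x::order set \<Rightarrow> 'v::order set
    \<Rightarrow> ('t \<Rightarrow> 'u \<Rightarrow> 'x \<Rightarrow> 'v \<Rightarrow> 'z::order)
    \<Rightarrow> ('t set \<Rightarrow> 'u set \<Rightarrow> 'x set \<Rightarrow> 'v set \<Rightarrow> 'z set) \<Rightarrow> bool"
  where "inclusion_monotonic_extension T Du Dx Dv g G \<longleftrightarrow>
    (\<forall>T'\<in>compact_intervals T. \<forall>U'\<in>compact_intervals Du.
     \<forall>Z'\<in>compact_intervals Dx. \<forall>V'\<in>compact_intervals Dv. G T' U' Z' V' \<in> compact_intervals UNIV) \<and>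
    (\<forall>t\<in>T. \<forall>u\<in>Du. \<forall>z\<in>Dx. \<forall>v\<in>Dv. G {t} {u} {z} {v} = {g t u z v}) \<and>
    (\<forall>T1\<in>compact_intervals T. \<forall>T2\<in>compact_intervals T.
     \<forall>U1\<in>compact_intervals Du. \<forall>U2\<in>compact_intervals Du.
     \<forall>Z1\<in>compact_intervals Dx. \<forall>Z2\<in>compact_intervals Dx.
     \<forall>V1\<in>compact_intervals Dv. \<forall>V2\<in>compact_intervals Dv.
       T1 \<subseteq> T2 \<and> U1 \<subseteq> U2 \<and> Z1 \<subseteq> Z2 \<and> V1 \<subseteq> V2 \<longrightarrow> G T1 U1 Z1 V1 \<subseteq> G T2 U2 Z2 V2)"

definition lo_hat :: "real^'n \<Rightarrow> real^'n \<Rightarrow> real^'n"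
  where "lo_hat v w = (\<chi> j. min (v $ j) ((v $ j + w $ j) / 2))"

definition hi_hat :: "real^'n \<Rightarrow> real^'n \<Rightarrow> real^'n"
  where "hi_hat v w = (\<chi> j. max (w $ j) ((v $ j + w $ j) / 2))"

definition face_L :: "'n \<Rightarrow> real^'n \<Rightarrow> real^'n \<Rightarrow> (real^'n) set"
  where "face_L i v w = {z \<in> {lo_hat v w..hi_hat v w}. z $ i = lo_hat v w $ i}"

definition face_U :: "'n \<Rightarrow> real^'n \<Rightarrow> real^'n \<Rightarrow> (real^'n) set"
  where "face_U i v w = {z \<in> {lo_hat v w..hi_hat v w}. z $ i = hi_hat v w $ i}"

definition median3 :: "real \<Rightarrow> real \<Rightarrow> real \<Rightarrow> real"
  where "median3 a b c = sort [a, b, c] ! 1"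

text \<open>
  The loops of the tightening procedure run over the index types in the order of
  \<^const>\<open>Enum.enum\<close>, which for a sum type lists the left summand first. The state of the
  procedure is the pair of current end points.
\<close>

definition tighten_step ::
  "real^'n^'k \<Rightarrow> real^'k \<Rightarrow> 'k \<Rightarrow> 'n \<Rightarrow> (real^'n) \<times> (real^'n) \<Rightarrow> (real^'n) \<times> (real^'n)"
  where "tighten_step M d i j = (\<lambda>(v, w).
    let m = M $ i $ j;
        \<gamma> = median3 (v $ j) (w $ j)
              (1 / m * (d $ i + (\<Sum>k\<in>UNIV - {j}. max (- M $ i $ k * v $ k) (- M $ i $ k * w $ k))))
    in if m > 0 then (v, \<chi> k. if k = j then \<gamma> else w $ k)
       else if m < 0 then (\<chi> k. if k = j then \<gamma> else v $ k, w)
       else (v, w))"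

definition tighten_bounds ::
  "real^'n::enum^'k::enum \<Rightarrow> real^'k::enum \<Rightarrow> (real^'n::enum) \<times> (real^'n::enum) \<Rightarrow> (real^'n::enum) \<times> (real^'n::enum)"
  where "tighten_bounds M d =
    fold (\<lambda>i. fold (\<lambda>j. tighten_step M d i j) Enum.enum) Enum.enum"

text \<open>On a nonempty interval, \<^const>\<open>Inf\<close> and \<^const>\<open>Sup\<close> (componentwise) recover the end points.\<close>

definition interval_tightening ::
  "(real^'n::enum) set \<Rightarrow> real^'k::enum \<Rightarrow> real^'n::enum^'k::enum \<Rightarrow> (real^'n::enum) set"
  where "interval_tightening Z d M =
    (case tighten_bounds M d (Inf Z, Sup Z) of (v, w) \<Rightarrow> {v..w})"

lemma interval_tightening_interval:
  assumes "v \<le> w"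
  shows "interval_tightening {v..w} d M = (case tighten_bounds M d (v, w) of (v', w') \<Rightarrow> {v'..w'})"
  using assms by (simp add: interval_tightening_def)

text \<open>The stacked matrix and vector have row index type \<^typ>\<open>'m + 'm\<close>.\<close>

definition measurement_tightening ::
  "real^'n::enum^'m::enum \<Rightarrow> (real \<Rightarrow> real^'m::enum) \<Rightarrow> (real \<Rightarrow> real^'m::enum)
    \<Rightarrow> (real^'n::enum) set \<Rightarrow> real \<Rightarrow> real^'m::enum \<Rightarrow> (real^'n::enum) set"
  where "measurement_tightening C vL vU Z t y =
    interval_tightening Z
      (\<chi> r. case r of Inl i \<Rightarrow> (y - vL t) $ i | Inr i \<Rightarrow> (- y + vU t) $ i)
      (\<chi> r. case r of Inl i \<Rightarrow> C $ i | Inr i \<Rightarrow> - C $ i)"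

end

theory Submission
  imports Defs
begin

text \<open>
  Let \<open>x\<close> be a trajectory consistent with the measurements, and measure by how much it leaves the
  tube: \<open>\<delta> t\<close> is the sum over \<open>i\<close> of the positive parts of the violations \<open>xL t $ i - x t $ i\<close> and
  \<open>x t $ i - xU t $ i\<close>. A violation that is positive turns out to grow, at almost every time, at rate
  at most \<open>\<beta> t * \<delta> t\<close> with an integrable \<open>\<beta>\<close>. Since \<open>\<delta>\<close> starts at \<open>0\<close>, a Gronwall argument
  (\<open>positive_parts_vanish\<close>) shows that it stays at \<open>0\<close>.

  For the growth bound, fix a time at which \<open>x $ i < xL $ i\<close>. Then \<open>x\<close> lies within \<open>\<delta>\<close> of the face on
  which \<open>xL $ i\<close> is propagated (\<open>near_box_face_L\<close>). The state satisfies the inequalities \<open>M *v x \<le> d\<close>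
  used for tightening. Therefore tightening a box that almost contains \<open>x\<close> keeps it nonempty and
  increases the error by at most a factor that depends on \<open>M\<close> alone
  (\<open>measurement_tightening_keeps_near_point\<close>). So the tightened box contains a point \<open>z\<close> with
  \<open>norm (z - x) \<le> K * \<delta>\<close>. By inclusion monotonicity the lower end point \<open>fL $ i\<close> on the tightened box is
  at most \<open>fhat $ i\<close> at \<open>z\<close>. The Lipschitz assumption compares \<open>fhat\<close> at \<open>z\<close> with \<open>fhat\<close> at \<open>x\<close>, and
  there the terms with \<open>L\<close> cancel against \<open>L *v y\<close>, because \<open>y = C *v x + v\<close>
  (\<open>innovation_deviation\<close>). What is left is the derivative of \<open>x $ i\<close>. Upper bounds are treated in the
  same way. The Lipschitz constant is valid only near a point, which is taken to be the value of \<open>x\<close> at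
  a time when \<open>\<delta> = 0\<close>; the estimate then holds for a short while after that time, and this is all
  that the Gronwall argument asks for.

  Absolute continuity enters through one fact: an almost everywhere bound on the derivative bounds the
  increment by an integral (\<open>absolutely_continuous_increment_le_integral\<close>). Its proof compares Riemann
  sums directly, using the gauge definition of the integral.
\<close>

section \<open>Absolutely continuous functions\<close>

lemma absolutely_continuous_onE:
  assumes "absolutely_continuous_on S g" "\<epsilon> > 0"
  obtains \<delta> where "\<delta> > 0" "\<forall>\<D>. \<D> division_of \<Union>\<D> \<longrightarrow> \<Union>\<D> \<subseteq> S \<longrightarrow> (\<Sum>K\<in>\<D>. Sup K - Inf K) < \<delta>
        \<longrightarrow> (\<Sum>K\<in>\<D>. norm (g (Sup K) - g (Inf K))) < \<epsilon>"
  using assms(1)[unfolded absolutely_continuous_on_def imp_conjL, THEN spec, THEN mp, OF assms(2)]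
  by (elim exE conjE) (rule that)

lemma absolutely_continuous_onI:
  assumes "\<And>\<epsilon>. \<epsilon> > 0 \<Longrightarrow> \<exists>\<delta>>0. \<forall>\<D>. \<D> division_of \<Union>\<D> \<longrightarrow> \<Union>\<D> \<subseteq> S \<longrightarrow> (\<Sum>K\<in>\<D>. Sup K - Inf K) < \<delta>
        \<longrightarrow> (\<Sum>K\<in>\<D>. norm (g (Sup K) - g (Inf K))) < \<epsilon>"
  shows "absolutely_continuous_on S g"
  unfolding absolutely_continuous_on_def by (simp only: imp_conjL, intro allI impI, rule assms)

lemma absolutely_continuous_on_subset:
  assumes "absolutely_continuous_on S g" "R \<subseteq> S"
  shows "absolutely_continuous_on R g"
proof (rule absolutely_continuous_onI)
  fix \<epsilon> :: real assume "\<epsilon> > 0"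
  with assms(1) obtain \<delta> where "\<delta> > 0" and \<delta>: "\<forall>\<D>. \<D> division_of \<Union>\<D> \<longrightarrow> \<Union>\<D> \<subseteq> S
      \<longrightarrow> (\<Sum>K\<in>\<D>. Sup K - Inf K) < \<delta> \<longrightarrow> (\<Sum>K\<in>\<D>. norm (g (Sup K) - g (Inf K))) < \<epsilon>"
    by (rule absolutely_continuous_onE)
  show "\<exists>\<delta>>0. \<forall>\<D>. \<D> division_of \<Union>\<D> \<longrightarrow> \<Union>\<D> \<subseteq> R \<longrightarrow> (\<Sum>K\<in>\<D>. Sup K - Inf K) < \<delta>
      \<longrightarrow> (\<Sum>K\<in>\<D>. norm (g (Sup K) - g (Inf K))) < \<epsilon>"
    using \<delta> order_trans[OF _ assms(2)] by (intro exI[of _ \<delta>] conjI allI impI \<open>\<delta> > 0\<close>) simp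
qed

lemma absolutely_continuous_on_component:
  fixes g :: "real \<Rightarrow> real^'n"
  assumes "absolutely_continuous_on S g"
  shows "absolutely_continuous_on S (\<lambda>t. g t $ i)"
proof (rule absolutely_continuous_onI)
  fix \<epsilon> :: real assume "\<epsilon> > 0"
  with assms obtain \<delta> where "\<delta> > 0" and \<delta>: "\<forall>\<D>. \<D> division_of \<Union>\<D> \<longrightarrow> \<Union>\<D> \<subseteq> S \<longrightarrow> (\<Sum>K\<in>\<D>. Sup K - Inf K) < \<delta>
        \<longrightarrow> (\<Sum>K\<in>\<D>. norm (g (Sup K) - g (Inf K))) < \<epsilon>"
    by (rule absolutely_continuous_onE)
  have le: "(\<Sum>K\<in>\<D>. norm (g (Sup K) $ i - g (Inf K) $ i)) \<le> (\<Sum>K\<in>\<D>. norm (g (Sup K) - g (Inf K)))" for \<D>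
    by (simp only: vector_minus_component[symmetric] real_norm_def) (intro sum_mono component_le_norm_cart)
  show "\<exists>\<delta>>0. \<forall>\<D>. \<D> division_of \<Union>\<D> \<longrightarrow> \<Union>\<D> \<subseteq> S \<longrightarrow> (\<Sum>K\<in>\<D>. Sup K - Inf K) < \<delta>
        \<longrightarrow> (\<Sum>K\<in>\<D>. norm (g (Sup K) $ i - g (Inf K) $ i)) < \<epsilon>"
    by (intro exI[of _ \<delta>] conjI allI impI \<open>\<delta> > 0\<close> le_less_trans[OF le \<delta>[rule_format]])
qed

lemma absolutely_continuous_on_diff:
  assumes "absolutely_continuous_on S g" "absolutely_continuous_on S h"
  shows "absolutely_continuous_on S (\<lambda>t. g t - h t)"
proof (rule absolutely_continuous_onI)
  fix \<epsilon> :: real assume "\<epsilon> > 0"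
  then have half: "\<epsilon> / 2 > 0" by simp
  obtain \<delta>1 where "\<delta>1 > 0" and 1: "\<forall>\<D>. \<D> division_of \<Union>\<D> \<longrightarrow> \<Union>\<D> \<subseteq> S \<longrightarrow> (\<Sum>K\<in>\<D>. Sup K - Inf K) < \<delta>1
        \<longrightarrow> (\<Sum>K\<in>\<D>. norm (g (Sup K) - g (Inf K))) < \<epsilon> / 2"
    by (rule absolutely_continuous_onE[OF assms(1) half])
  obtain \<delta>2 where "\<delta>2 > 0" and 2: "\<forall>\<D>. \<D> division_of \<Union>\<D> \<longrightarrow> \<Union>\<D> \<subseteq> S \<longrightarrow> (\<Sum>K\<in>\<D>. Sup K - Inf K) < \<delta>2
        \<longrightarrow> (\<Sum>K\<in>\<D>. norm (h (Sup K) - h (Inf K))) < \<epsilon> / 2"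
    by (rule absolutely_continuous_onE[OF assms(2) half])
  have le: "(\<Sum>K\<in>\<D>. norm (g (Sup K) - h (Sup K) - (g (Inf K) - h (Inf K))))
      \<le> (\<Sum>K\<in>\<D>. norm (g (Sup K) - g (Inf K))) + (\<Sum>K\<in>\<D>. norm (h (Sup K) - h (Inf K)))" for \<D>
    unfolding sum.distrib[symmetric] by (intro sum_mono) norm
  have "(\<Sum>K\<in>\<D>. norm (g (Sup K) - h (Sup K) - (g (Inf K) - h (Inf K)))) < \<epsilon>"
    if "\<D> division_of \<Union>\<D>" "\<Union>\<D> \<subseteq> S" "(\<Sum>K\<in>\<D>. Sup K - Inf K) < min \<delta>1 \<delta>2" for \<D>
    using le[of \<D>] 1[rule_format, OF that(1,2)] 2[rule_format, OF that(1,2)] that(3) by linarith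
  moreover have "min \<delta>1 \<delta>2 > 0"
    using \<open>\<delta>1 > 0\<close> \<open>\<delta>2 > 0\<close> by simp
  ultimately show "\<exists>\<delta>>0. \<forall>\<D>. \<D> division_of \<Union>\<D> \<longrightarrow> \<Union>\<D> \<subseteq> S \<longrightarrow> (\<Sum>K\<in>\<D>. Sup K - Inf K) < \<delta>
        \<longrightarrow> (\<Sum>K\<in>\<D>. norm (g (Sup K) - h (Sup K) - (g (Inf K) - h (Inf K)))) < \<epsilon>"
    by (intro exI[of _ "min \<delta>1 \<delta>2"] conjI allI impI)
qed

lemma absolutely_continuous_on_imp_continuous_on:
  assumes ac: "absolutely_continuous_on {a..b} g"
  shows "continuous_on {a..b} g"
  unfolding continuous_on_iff
proof (intro ballI allI impI)
  fix s \<epsilon> :: real assume s: "s \<in> {a..b}" and "\<epsilon> > 0"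
  from ac \<open>\<epsilon> > 0\<close> obtain \<delta> where "\<delta> > 0" and \<delta>: "\<forall>\<D>. \<D> division_of \<Union>\<D> \<longrightarrow> \<Union>\<D> \<subseteq> {a..b} \<longrightarrow> (\<Sum>K\<in>\<D>. Sup K - Inf K) < \<delta>
        \<longrightarrow> (\<Sum>K\<in>\<D>. norm (g (Sup K) - g (Inf K))) < \<epsilon>"
    by (rule absolutely_continuous_onE)
  have "dist (g t) (g s) < \<epsilon>" if "t \<in> {a..b}" "dist t s < \<delta>" for t
  proof -
    have "{{min s t..max s t}} division_of \<Union>{{min s t..max s t}}"
      using division_of_self[of "min s t" "max s t"] by simp
    then show ?thesis
      using \<delta>[rule_format, of "{{min s t..max s t}}"] s that
      by (auto simp: dist_real_def dist_norm min_def max_def norm_minus_commute split: if_splits)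
  qed
  with \<open>\<delta> > 0\<close> show "\<exists>\<delta>>0. \<forall>t\<in>{a..b}. dist t s < \<delta> \<longrightarrow> dist (g t) (g s) < \<epsilon>"
    by blast
qed

lemma sum_lengths_le_measure:
  fixes \<D> :: "real set set"
  assumes "\<D> division_of \<Union>\<D>" "\<Union>\<D> \<subseteq> G" "G \<in> lmeasurable"
  shows "(\<Sum>K\<in>\<D>. Sup K - Inf K) \<le> measure lebesgue G"
proof -
  have "Sup K - Inf K = measure lebesgue K" if "K \<in> \<D>" for K
    using division_ofD(3,4)[OF assms(1) that] by (auto simp: measure_completion)
  then have "(\<Sum>K\<in>\<D>. Sup K - Inf K) = measure lebesgue (\<Union>\<D>)"
    using content_division[OF assms(1)] by simp
  also have "\<dots> \<le> measure lebesgue G"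
    by (intro measure_mono_fmeasurable assms fmeasurableD lmeasurable_division[OF assms(1)])
  finally show ?thesis .
qed

text \<open>
  One half of the fundamental theorem of calculus, read off from Riemann sums for a gauge. On an
  interval with a tag outside \<open>N\<close> the derivative at the tag controls the increment of \<open>\<phi>\<close>. The
  intervals with tags in \<open>N\<close> are forced into an open set around \<open>N\<close> of small measure, so by absolute
  continuity their increments have a small sum.
\<close>

lemma absolutely_continuous_increment_le_integral:
  fixes \<phi> h :: "real \<Rightarrow> real"
  assumes "a \<le> b" and ac: "absolutely_continuous_on {a..b} \<phi>"
    and h: "(h has_integral I) {a..b}" and N: "negligible N"
    and deriv: "\<And>t. t \<in> {a..b} - N \<Longrightarrow> \<exists>D\<le>h t. (\<phi> has_real_derivative D) (at t within {a..b})"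
  shows "\<phi> b - \<phi> a \<le> I"
proof -
  \<comment> \<open>The integrand may be changed on \<open>N\<close>, so that tags in \<open>N\<close> add nothing to the Riemann sum.\<close>
  define k where "k t = (if t \<in> N then 0 else h t)" for t
  have k: "(k has_integral I) {a..b}"
    by (rule has_integral_spike[OF N _ h]) (simp add: k_def)
  have bound: "\<phi> b - \<phi> a \<le> I + e * (2 + (b - a))" if "e > 0" for e
  proof -
    obtain \<gamma>1 where "gauge \<gamma>1" and \<gamma>1: "\<forall>p. p tagged_division_of {a..b} \<and> \<gamma>1 fine p
        \<longrightarrow> norm ((\<Sum>(x,K)\<in>p. measure lborel K *\<^sub>R k x) - I) < e"
      using k[unfolded has_integral_real, rule_format, OF \<open>e > 0\<close>] by (elim exE conjE)
    obtain \<delta> where "\<delta> > 0" and \<delta>: "\<forall>\<D>. \<D> division_of \<Union>\<D> \<longrightarrow> \<Union>\<D> \<subseteq> {a..b} \<longrightarrow> (\<Sum>K\<in>\<D>. Sup K - Inf K) < \<delta>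
        \<longrightarrow> (\<Sum>K\<in>\<D>. \<bar>\<phi> (Sup K) - \<phi> (Inf K)\<bar>) < e"
      by (rule absolutely_continuous_onE[OF ac \<open>e > 0\<close>, unfolded real_norm_def])
    have Nnull: "N \<in> null_sets lebesgue"
      using N negligible_iff_null_sets by blast
    then obtain G where G: "open G" "N \<subseteq> G" "G - N \<in> lmeasurable" "emeasure lebesgue (G - N) < ennreal \<delta>"
      using sets_lebesgue_outer_open[OF _ \<open>\<delta> > 0\<close>] by blast
    have "(G - N) \<union> N \<in> lmeasurable" 
      using G(3) Nnull by (intro fmeasurable.Un) (auto simp: fmeasurableI_null_sets)
    then have Gm: "G \<in> lmeasurable"
      using G(2) by (simp add: Un_absorb2)
    have "measure lebesgue G = measure lebesgue (G - N)"
      using Gm Nnull by (simp add: measure_Diff_null_set fmeasurableD)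
    also have "\<dots> < \<delta>"
      using G(3,4) \<open>\<delta> > 0\<close> by (simp add: emeasure_eq_measure2 ennreal_less_iff)
    finally have G\<delta>: "measure lebesgue G < \<delta>" .
    have "\<exists>d>0. \<forall>s\<in>{a..b}. \<bar>s - t\<bar> < d \<longrightarrow> \<bar>\<phi> s - \<phi> t - D * (s - t)\<bar> \<le> e * \<bar>s - t\<bar>"
      if "(\<phi> has_real_derivative D) (at t within {a..b})" for t D
      using that \<open>e > 0\<close> unfolding has_field_derivative_def has_derivative_within_alt
      by auto
    with deriv have "\<forall>t\<in>{a..b} - N. \<exists>d>0. \<exists>D\<le>h t. \<forall>s\<in>{a..b}. \<bar>s - t\<bar> < d \<longrightarrow> \<bar>\<phi> s - \<phi> t - D * (s - t)\<bar> \<le> e * \<bar>s - t\<bar>"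
      by meson
    then obtain d where d: "\<And>t. t \<in> {a..b} - N \<Longrightarrow> d t > 0"
      "\<And>t. t \<in> {a..b} - N \<Longrightarrow> \<exists>D\<le>h t. \<forall>s\<in>{a..b}. \<bar>s - t\<bar> < d t \<longrightarrow> \<bar>\<phi> s - \<phi> t - D * (s - t)\<bar> \<le> e * \<bar>s - t\<bar>"
      by metis
    define \<gamma>2 where "\<gamma>2 t = (if t \<in> N then G else ball t (if t \<in> {a..b} then d t else 1))" for t
    have "gauge \<gamma>2"
      using G(1,2) d(1) by (auto simp: gauge_def \<gamma>2_def)
    then obtain p where p: "p tagged_division_of {a..b}" and "(\<lambda>t. \<gamma>1 t \<inter> \<gamma>2 t) fine p"
      using fine_division_exists_real[OF gauge_Int[OF \<open>gauge \<gamma>1\<close>]] by blast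
    then have fine: "\<gamma>1 fine p" "\<gamma>2 fine p"
      by (auto simp: fine_Int)
    note pD = tagged_division_ofD[OF p]
    define q where "q = {(x,K) \<in> p. x \<in> N}"
    have "q \<subseteq> p" and "finite p" by (auto simp: q_def pD(1))
    have good: "\<phi> (Sup K) - \<phi> (Inf K) \<le> measure lborel K * k x + e * measure lborel K" if "(x,K) \<in> p - q" for x K
    proof -
      have xK: "(x,K) \<in> p" "x \<notin> N" using that by (auto simp: q_def)
      obtain c c' where K: "K = {c..c'}" using pD(4)[OF xK(1)] by auto
      have x: "c \<le> x" "x \<le> c'" using pD(2)[OF xK(1)] K by auto
      have cs: "c \<in> {a..b}" "c' \<in> {a..b}" "x \<in> {a..b} - N" using pD(3)[OF xK(1)] K x xK(2) by auto
      have "K \<subseteq> ball x (d x)"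
        using fine(2) xK cs by (fastforce simp: fine_def \<gamma>2_def)
      moreover have "c \<in> K" "c' \<in> K"
        using K x by auto
      ultimately have "c \<in> ball x (d x)" "c' \<in> ball x (d x)"
        by blast+
      then have near: "\<bar>c - x\<bar> < d x" "\<bar>c' - x\<bar> < d x"
        by (simp_all add: dist_real_def abs_minus_commute)
      obtain D where "D \<le> h x" "\<And>s. s \<in> {a..b} \<Longrightarrow> \<bar>s - x\<bar> < d x \<Longrightarrow> \<bar>\<phi> s - \<phi> x - D * (s - x)\<bar> \<le> e * \<bar>s - x\<bar>"
        using d(2)[OF cs(3)] by blast
      from this(2)[OF cs(1) near(1)] this(2)[OF cs(2) near(2)]
      have "\<phi> c' - \<phi> c \<le> D * (c' - x) - D * (c - x) + e * \<bar>c' - x\<bar> + e * \<bar>c - x\<bar>"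
        by linarith
      also have "\<dots> = (c' - c) * D + e * (c' - c)" using x by (simp add: algebra_simps)
      also have "\<dots> \<le> (c' - c) * h x + e * (c' - c)"
        using \<open>D \<le> h x\<close> x by (simp add: mult_left_mono)
      finally show ?thesis using K x xK(2) by (simp add: k_def)
    qed
    have "p tagged_partial_division_of {a..b}"
      using p by (simp add: tagged_division_of_def)
    then have qtag: "q tagged_division_of (\<Union>(snd ` q))"
      by (intro tagged_partial_division_of_Union_self tagged_partial_division_subset[OF _ \<open>q \<subseteq> p\<close>])
    then have qdiv: "(snd ` q) division_of (\<Union>(snd ` q))"
      by (rule division_of_tagged_division)
    have "\<Union>(snd ` q) \<subseteq> G"
      using fine(2) by (fastforce simp: q_def \<gamma>2_def fine_def)
    then have "(\<Sum>K\<in>snd ` q. Sup K - Inf K) < \<delta>"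
      using sum_lengths_le_measure[OF qdiv _ Gm] G\<delta> by linarith
    moreover have "\<Union>(snd ` q) \<subseteq> {a..b}"
      using pD(3) \<open>q \<subseteq> p\<close> by fastforce
    ultimately have "(\<Sum>K\<in>snd ` q. \<bar>\<phi> (Sup K) - \<phi> (Inf K)\<bar>) < e"
      using \<delta>[rule_format, OF qdiv] by blast
    moreover have "(\<Sum>(x,K)\<in>q. \<bar>\<phi> (Sup K) - \<phi> (Inf K)\<bar>) = (\<Sum>K\<in>snd ` q. \<bar>\<phi> (Sup K) - \<phi> (Inf K)\<bar>)"
    proof -
      \<comment> \<open>Passing from tagged intervals to intervals requires an increment that vanishes on degenerate
        intervals, also on the empty one, whose \<open>Sup\<close> and \<open>Inf\<close> are arbitrary.\<close>
      define inc where "inc K = (if K = {} then 0 else \<bar>\<phi> (Sup K) - \<phi> (Inf K)\<bar>)" for K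
      have "inc K = \<bar>\<phi> (Sup K) - \<phi> (Inf K)\<bar>" if "(x,K) \<in> q" for x K
        using pD(2) \<open>q \<subseteq> p\<close> that by (auto simp: inc_def)
      then have "(\<Sum>(x,K)\<in>q. inc K) = (\<Sum>(x,K)\<in>q. \<bar>\<phi> (Sup K) - \<phi> (Inf K)\<bar>)"
        "sum inc (snd ` q) = (\<Sum>K\<in>snd ` q. \<bar>\<phi> (Sup K) - \<phi> (Inf K)\<bar>)"
        by (auto intro!: sum.cong)
      moreover have "(\<Sum>(x,K)\<in>q. inc K) = sum inc (snd ` q)"
      proof (rule sum.over_tagged_division_lemma[OF qtag])
        fix u v :: real assume "box u v = {}"
        then have "v \<le> u" by auto
        then show "inc (cbox u v) = 0"
          by (cases "u = v") (auto simp: inc_def)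
      qed
      ultimately show ?thesis by simp
    qed
    moreover have "(\<Sum>(x,K)\<in>q. \<phi> (Sup K) - \<phi> (Inf K)) \<le> (\<Sum>(x,K)\<in>q. \<bar>\<phi> (Sup K) - \<phi> (Inf K)\<bar>)"
      by (intro sum_mono) auto
    ultimately have bad: "(\<Sum>(x,K)\<in>q. \<phi> (Sup K) - \<phi> (Inf K)) < e"
      by linarith
    have kq: "(\<Sum>(x,K)\<in>q. measure lborel K * k x) = 0"
      by (intro sum.neutral) (auto simp: q_def k_def)
    have split: "sum F p = sum F (p - q) + sum F q" for F :: "real \<times> real set \<Rightarrow> real"
      using sum.subset_diff[OF \<open>q \<subseteq> p\<close> \<open>finite p\<close>] .
    have "(\<Sum>(x,K)\<in>p - q. \<phi> (Sup K) - \<phi> (Inf K)) \<le> (\<Sum>(x,K)\<in>p - q. measure lborel K * k x + e * measure lborel K)"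
      using good by (intro sum_mono) auto
    also have "\<dots> = (\<Sum>(x,K)\<in>p - q. measure lborel K * k x) + e * (\<Sum>(x,K)\<in>p - q. measure lborel K)"
      by (simp add: split_def sum.distrib sum_distrib_left)
    also have "(\<Sum>(x,K)\<in>p - q. measure lborel K) \<le> (\<Sum>(x,K)\<in>p. measure lborel K)"
      using \<open>finite p\<close> by (intro sum_mono2) auto
    also have "(\<Sum>(x,K)\<in>p. measure lborel K) = b - a"
      using additive_content_tagged_division[of p a b] p \<open>a \<le> b\<close> by simp
    finally have 
      "(\<Sum>(x,K)\<in>p - q. \<phi> (Sup K) - \<phi> (Inf K)) \<le> (\<Sum>(x,K)\<in>p - q. measure lborel K * k x) + e * (b - a)"
      using \<open>e > 0\<close> by simp
    moreover have "(\<Sum>(x,K)\<in>p. \<phi> (Sup K) - \<phi> (Inf K)) = \<phi> b - \<phi> a"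
      by (rule additive_tagged_division_1[OF \<open>a \<le> b\<close> p])
    ultimately show ?thesis
      using \<gamma>1[rule_format, OF conjI, OF p fine(1)] bad kq split[of "\<lambda>(x,K). \<phi> (Sup K) - \<phi> (Inf K)"]
        split[of "\<lambda>(x,K). measure lborel K * k x"]
      by (simp add: algebra_simps)
  qed
  show ?thesis
  proof (rule field_le_epsilon)
    fix e :: real assume "e > 0"
    then show "\<phi> b - \<phi> a \<le> I + e"
      using bound[of "e / (2 + (b - a))"] \<open>a \<le> b\<close> by simp
  qed
qed

section \<open>Gronwall argument for positive parts\<close>

text \<open>
  After the last time at which \<open>\<phi> \<le> 0\<close> the growth bound is available throughout. In this way the
  positive part of \<open>\<phi>\<close>, which may fail to be differentiable, is never differentiated.
\<close>

lemma absolutely_continuous_le_integral_if_growth_when_positive: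
  fixes \<phi> h :: "real \<Rightarrow> real"
  assumes "a \<le> b" and ac: "absolutely_continuous_on {a..b} \<phi>" and init: "\<phi> a \<le> 0"
    and h: "h integrable_on {a..b}" "\<And>t. t \<in> {a..b} \<Longrightarrow> 0 \<le> h t" and N: "negligible N"
    and deriv: "\<And>t. t \<in> {a..b} - N \<Longrightarrow> \<phi> t > 0 \<Longrightarrow>
                  \<exists>D\<le>h t. (\<phi> has_real_derivative D) (at t within {a..b})"
  shows "\<phi> b \<le> integral {a..b} h"
proof (cases "\<phi> b \<le> 0")
  case True
  then show ?thesis
    using integral_nonneg[OF h] by simp
next
  case False
  have cont: "continuous_on {a..b} \<phi>"
    by (rule absolutely_continuous_on_imp_continuous_on[OF ac])
  have "closed ({a..b} \<inter> \<phi> -` {..0})"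
    by (intro continuous_closed_preimage cont) auto
  then have "compact ({a..b} \<inter> \<phi> -` {..0})"
    by (metis compact_Icc compact_Int_closed inf.left_idem)
  moreover have "a \<in> {a..b} \<inter> \<phi> -` {..0}"
    using \<open>a \<le> b\<close> init by simp
  ultimately obtain s where s: "s \<in> {a..b} \<inter> \<phi> -` {..0}" and last: "\<And>t. t \<in> {a..b} \<inter> \<phi> -` {..0} \<Longrightarrow> t \<le> s"
    using compact_attains_sup by (metis empty_iff)
  then have sab: "a \<le> s" "s \<le> b" "\<phi> s \<le> 0" by auto
  have sub: "{s..b} \<subseteq> {a..b}" using sab by auto
  have hs: "h integrable_on {s..b}"
    using integrable_on_subinterval[OF h(1) sub] .
  have "\<phi> b - \<phi> s \<le> integral {s..b} h"
  proof (rule absolutely_continuous_increment_le_integral[OF sab(2) _ integrable_integral[OF hs]])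
    show "absolutely_continuous_on {s..b} \<phi>"
      by (rule absolutely_continuous_on_subset[OF ac sub])
    show "negligible (insert s N)" using N by simp
    fix t assume t: "t \<in> {s..b} - insert s N"
    then have "\<not> t \<le> s" and tab: "t \<in> {a..b} - N"
      using sub by auto
    then have "\<phi> t > 0"
      using last[of t] by force
    then obtain D where "D \<le> h t" "(\<phi> has_real_derivative D) (at t within {a..b})"
      using deriv tab by blast
    then show "\<exists>D\<le>h t. (\<phi> has_real_derivative D) (at t within {s..b})"
      using DERIV_subset[OF _ sub] by blast
  qed
  also have "integral {s..b} h \<le> integral {a..b} h"
    using sub hs h by (intro integral_subset_le) auto
  finally show ?thesis
    using sab(3) by linarith
qed

text \<open>
  A Gronwall lemma for the sum \<open>\<delta>\<close> of the positive parts of finitely many functions. If \<open>\<delta>\<close> became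
  positive, take the last zero \<open>s\<close> before that, and then an interval to the right of \<open>s\<close> so short
  that the integral of \<open>\<beta>\<close> over it is less than \<open>1 / (2 * n)\<close>, where \<open>n\<close> is the number of functions. At
  the point where \<open>\<delta>\<close> is largest on that interval, each positive part is at most \<open>\<delta> / (2 * n)\<close>, hence
  \<open>\<delta> \<le> \<delta> / 2\<close>. Working on a short
  interval instead of with an integrating factor allows \<open>\<beta>\<close> to be given only locally, after a time at
  which \<open>\<delta> = 0\<close>.
\<close>

lemma positive_parts_vanish:
  fixes \<phi> :: "'k::finite \<Rightarrow> real \<Rightarrow> real"
  assumes ac: "\<And>k. absolutely_continuous_on {a..b} (\<phi> k)" and init: "\<And>k. \<phi> k a \<le> 0"
    and growth: "\<And>s. a \<le> s \<Longrightarrow> s < b \<Longrightarrow> (\<And>k. \<phi> k s \<le> 0) \<Longrightarrow>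
      \<exists>e \<beta> N. s < e \<and> e \<le> b \<and> \<beta> integrable_on {s..e} \<and> (\<forall>t\<in>{s..e}. 0 \<le> \<beta> t) \<and> negligible N \<and>
        (\<forall>k. \<forall>t\<in>{s..e} - N. \<phi> k t > 0 \<longrightarrow>
          (\<exists>D \<le> \<beta> t * (\<Sum>k\<in>UNIV. max 0 (\<phi> k t)). (\<phi> k has_real_derivative D) (at t within {s..e})))"
    and t: "t \<in> {a..b}"
  shows "\<phi> k t \<le> 0"
proof (rule ccontr)
  assume "\<not> \<phi> k t \<le> 0"
  define \<delta> where "\<delta> t = (\<Sum>k\<in>UNIV. max 0 (\<phi> k t))" for t
  have \<delta>_nonneg: "0 \<le> \<delta> t" for t
    by (simp add: \<delta>_def sum_nonneg)
  have \<phi>_le_\<delta>: "\<phi> k t \<le> \<delta> t" for k t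
    using member_le_sum[of k UNIV "\<lambda>k. max 0 (\<phi> k t)"] by (simp add: \<delta>_def)
  have "max 0 r = 0 \<longleftrightarrow> r \<le> 0" for r :: real
    by linarith
  then have \<delta>_eq_0: "\<delta> t = 0 \<longleftrightarrow> (\<forall>k. \<phi> k t \<le> 0)" for t
    by (simp add: \<delta>_def sum_nonneg_eq_0_iff)
  have cont: "continuous_on {a..b} \<delta>"
    unfolding \<delta>_def
    by (intro continuous_intros absolutely_continuous_on_imp_continuous_on ac)
  have cont_t: "continuous_on {a..t} \<delta>"
    using t by (intro continuous_on_subset[OF cont]) auto
  have "closed ({a..t} \<inter> \<delta> -` {0})"
    by (intro continuous_closed_preimage cont_t) auto
  then have "compact ({a..t} \<inter> \<delta> -` {0})"
    by (metis compact_Icc compact_Int_closed inf.left_idem)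
  moreover have "a \<in> {a..t} \<inter> \<delta> -` {0}"
    using t init by (simp add: \<delta>_eq_0)
  ultimately obtain s where s: "s \<in> {a..t} \<inter> \<delta> -` {0}"
      and last: "\<And>r. r \<in> {a..t} \<inter> \<delta> -` {0} \<Longrightarrow> r \<le> s"
    using compact_attains_sup by (metis empty_iff)
  have "\<delta> t \<noteq> 0"
    using \<open>\<not> \<phi> k t \<le> 0\<close> by (auto simp: \<delta>_eq_0)
  then have "s < t"
    using s by (cases "s = t") auto
  then have sab: "a \<le> s" "s < b" "\<And>k. \<phi> k s \<le> 0"
    using s t \<delta>_eq_0[of s] by auto
  obtain e \<beta> N where e: "s < e" "e \<le> b" and \<beta>: "\<beta> integrable_on {s..e}" "\<forall>t\<in>{s..e}. 0 \<le> \<beta> t"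
    and N: "negligible N"
    and D: "\<forall>k. \<forall>t\<in>{s..e} - N. \<phi> k t > 0 \<longrightarrow>
          (\<exists>D \<le> \<beta> t * \<delta> t. (\<phi> k has_real_derivative D) (at t within {s..e}))"
    using growth[OF sab] unfolding \<delta>_def[symmetric] by (elim exE conjE)
  define n where "n = real CARD('k)"
  have "n > 0" by (simp add: n_def)
  have "continuous_on {s..e} (\<lambda>r. integral {s..r} \<beta>)"
    by (rule indefinite_integral_continuous_1[OF \<beta>(1)])
  then obtain d where "d > 0" and d: "\<forall>r\<in>{s..e}. dist r s < d \<longrightarrow> dist (integral {s..r} \<beta>) (integral {s..s} \<beta>) < 1 / (2 * n)"
    unfolding continuous_on_iff using e(1) \<open>n > 0\<close>
    by (metis atLeastAtMost_iff less_eq_real_def zero_less_divide_1_iff zero_less_mult_iff zero_less_numeral)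
  define c where "c = min (min e t) (s + d / 2)"
  have c: "s < c" "c \<le> e" "c \<le> t" "c - s < d"
    using e(1) \<open>s < t\<close> \<open>d > 0\<close> by (auto simp: c_def min_def)
  have "continuous_on {s..c} \<delta>"
    using sab(1) c(2) e(2) by (intro continuous_on_subset[OF cont]) auto
  then obtain q where q: "q \<in> {s..c}" and max: "\<And>r. r \<in> {s..c} \<Longrightarrow> \<delta> r \<le> \<delta> q"
    using continuous_attains_sup[of "{s..c}" \<delta>] c(1) by auto
  have "\<delta> c \<noteq> 0"
    using last[of c] c sab(1) by auto
  then have "\<delta> q > 0"
    using max[of c] \<delta>_nonneg[of c] c(1) by auto
  have sub: "{s..q} \<subseteq> {s..e}" "{s..q} \<subseteq> {s..c}"
    using q c(2) by auto
  have small: "integral {s..q} \<beta> < 1 / (2 * n)"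
    using d[rule_format, of q] q c by (auto simp: dist_real_def)
  have "\<phi> k q \<le> \<delta> q / (2 * n)" for k
  proof -
    have \<beta>q: "\<beta> integrable_on {s..q}"
      using integrable_on_subinterval[OF \<beta>(1) sub(1)] .
    have "\<phi> k q \<le> integral {s..q} (\<lambda>r. \<delta> q * \<beta> r)"
    proof (rule absolutely_continuous_le_integral_if_growth_when_positive[where N = N])
      show "absolutely_continuous_on {s..q} (\<phi> k)"
        using sub sab(1) e(2) by (intro absolutely_continuous_on_subset[OF ac]) auto
      show "(\<lambda>r. \<delta> q * \<beta> r) integrable_on {s..q}"
        using \<beta>q by (rule integrable_on_mult_right)
      fix r assume r: "r \<in> {s..q} - N" and "\<phi> k r > 0"
      then obtain D where "D \<le> \<beta> r * \<delta> r" "(\<phi> k has_real_derivative D) (at r within {s..e})"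
        using D sub(1) by blast
      moreover have "\<beta> r * \<delta> r \<le> \<delta> q * \<beta> r"
        using max[of r] \<beta>(2) r sub by (subst mult.commute) (auto intro!: mult_right_mono)
      ultimately show "\<exists>D\<le>\<delta> q * \<beta> r. (\<phi> k has_real_derivative D) (at r within {s..q})"
        using DERIV_subset[OF _ sub(1)] by (meson order_trans)
    qed (use q \<beta>(2) sub(1) \<open>\<delta> q > 0\<close> sab(3) N in auto)
    also have "\<dots> = \<delta> q * integral {s..q} \<beta>"
      by (rule integral_mult_right)
    also have "\<dots> \<le> \<delta> q * (1 / (2 * n))"
      using small \<open>\<delta> q > 0\<close> by (intro mult_left_mono) auto
    finally show ?thesis by simp
  qed
  then have "\<delta> q \<le> (\<Sum>k\<in>(UNIV::'k set). \<delta> q / (2 * n))"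
    unfolding \<delta>_def[of q] using \<open>\<delta> q > 0\<close> \<open>n > 0\<close> 
    by (intro sum_mono max.boundedI) (simp_all add: \<delta>_def)
  also have "\<dots> = \<delta> q / 2"
    using \<open>n > 0\<close> by (simp add: n_def)
  finally show False
    using \<open>\<delta> q > 0\<close> by simp
qed

section \<open>Tightening a box that almost contains a consistent state\<close>

text \<open>
  The invariant of the tightening procedure. The box is required to be nonempty in addition, since
  otherwise its \<open>\<epsilon>\<close>-enlargement could contain \<open>x\<close> although the box has no point at all.
\<close>

definition near_box :: "real \<Rightarrow> real^'n \<Rightarrow> (real^'n) \<times> (real^'n) \<Rightarrow> bool"
  where "near_box \<epsilon> x = (\<lambda>(v, w). \<forall>j. v $ j \<le> w $ j \<and> v $ j - \<epsilon> \<le> x $ j \<and> x $ j \<le> w $ j + \<epsilon>)"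

text \<open>
  This is why a tightening step cannot empty an interval: the new end point stays between the old ones.
\<close>

lemma median3_eq_clamp: "a \<le> b \<Longrightarrow> median3 a b c = max a (min b c)"
  by (auto simp: median3_def min_def max_def)

text \<open>
  Solving one row of \<open>M *v x \<le> d\<close> for the term with \<open>x $ j\<close> and bounding the other terms over the box. That
  \<open>x\<close> may lie outside the box by \<open>\<epsilon>\<close> costs at most \<open>\<epsilon>\<close> times the absolute row sum.
\<close>

lemma row_inequality_bounds_entry:
  fixes M :: "real^'n^'k"
  assumes near: "near_box \<epsilon> x (v, w)" and "0 \<le> \<epsilon>" and row: "(M *v x) $ i \<le> d $ i"
  shows "M $ i $ j * x $ j \<le> d $ i + (\<Sum>k\<in>UNIV - {j}. max (- M $ i $ k * v $ k) (- M $ i $ k * w $ k))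
           + (\<Sum>k\<in>UNIV. \<bar>M $ i $ k\<bar>) * \<epsilon>"
proof -
  have entry: "- M $ i $ k * x $ k \<le> max (- M $ i $ k * v $ k) (- M $ i $ k * w $ k) + \<bar>M $ i $ k\<bar> * \<epsilon>" for k
  proof (cases "M $ i $ k \<ge> 0")
    case True
    then have "M $ i $ k * (v $ k - \<epsilon>) \<le> M $ i $ k * x $ k"
      using near by (intro mult_left_mono) (auto simp: near_box_def)
    then have "- M $ i $ k * x $ k \<le> - M $ i $ k * v $ k + \<bar>M $ i $ k\<bar> * \<epsilon>"
      using True by (simp add: algebra_simps)
    then show ?thesis by linarith
  next
    case False
    then have "M $ i $ k * (w $ k + \<epsilon>) \<le> M $ i $ k * x $ k"
      using near by (intro mult_left_mono_neg) (auto simp: near_box_def)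
    then have "- M $ i $ k * x $ k \<le> - M $ i $ k * w $ k + \<bar>M $ i $ k\<bar> * \<epsilon>"
      using False by (simp add: algebra_simps)
    then show ?thesis by linarith
  qed
  have "(M *v x) $ i = M $ i $ j * x $ j + (\<Sum>k\<in>UNIV - {j}. M $ i $ k * x $ k)"
    unfolding matrix_vector_mult_def by (simp add: sum.remove[of UNIV j])
  then have "M $ i $ j * x $ j \<le> d $ i + (\<Sum>k\<in>UNIV - {j}. - M $ i $ k * x $ k)"
    using row by (simp add: sum_negf)
  also have "(\<Sum>k\<in>UNIV - {j}. - M $ i $ k * x $ k)
      \<le> (\<Sum>k\<in>UNIV - {j}. max (- M $ i $ k * v $ k) (- M $ i $ k * w $ k) + \<bar>M $ i $ k\<bar> * \<epsilon>)"
    by (intro sum_mono entry)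
  also have "\<dots> = (\<Sum>k\<in>UNIV - {j}. max (- M $ i $ k * v $ k) (- M $ i $ k * w $ k))
      + (\<Sum>k\<in>UNIV - {j}. \<bar>M $ i $ k\<bar>) * \<epsilon>"
    by (simp add: sum.distrib sum_distrib_right)
  also have "(\<Sum>k\<in>UNIV - {j}. \<bar>M $ i $ k\<bar>) \<le> (\<Sum>k\<in>UNIV. \<bar>M $ i $ k\<bar>)"
    by (intro sum_mono2) auto
  finally show ?thesis
    using \<open>0 \<le> \<epsilon>\<close> by (simp add: mult_right_mono)
qed

text \<open>
  The end point that moves becomes either an old end point, with error \<open>\<epsilon>\<close>, or the value obtained by
  dividing the estimate for the row by \<open>M $ i $ j\<close>, which accounts for the quotient in the factor. For a
  zero entry the step does nothing, and with the convention for division by zero the factor is \<open>1\<close>.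
\<close>

lemma near_box_tighten_step:
  fixes M :: "real^'n^'k"
  assumes near: "near_box \<epsilon> x p" and "0 \<le> \<epsilon>" and row: "(M *v x) $ i \<le> d $ i"
  shows "near_box ((1 + (\<Sum>k\<in>UNIV. \<bar>M $ i $ k\<bar>) / \<bar>M $ i $ j\<bar>) * \<epsilon>) x (tighten_step M d i j p)"
proof -
  obtain v w where p: "p = (v, w)" by (cases p)
  let ?m = "M $ i $ j" and ?A = "\<Sum>k\<in>UNIV. \<bar>M $ i $ k\<bar>"
  define S where "S = (\<Sum>k\<in>UNIV - {j}. max (- M $ i $ k * v $ k) (- M $ i $ k * w $ k))"
  define \<beta> where "\<beta> = 1 / ?m * (d $ i + S)"
  define \<kappa> where "\<kappa> = (1 + ?A / \<bar>?m\<bar>) * \<epsilon>"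
  define a where "a = ?A / \<bar>?m\<bar> * \<epsilon>"
  have vw: "v $ k \<le> w $ k" "v $ k - \<epsilon> \<le> x $ k" "x $ k \<le> w $ k + \<epsilon>" for k
    using near by (auto simp: near_box_def p)
  have "0 \<le> ?A" by (simp add: sum_nonneg)
  then have \<kappa>: "\<epsilon> \<le> \<kappa>" "a \<le> \<kappa>"
    using \<open>0 \<le> \<epsilon>\<close> by (auto simp: \<kappa>_def a_def distrib_right)
  have wide: "v $ k - \<kappa> \<le> x $ k" "x $ k \<le> w $ k + \<kappa>" for k
    using vw(2,3)[of k] \<kappa>(1) by linarith+
  have bound: "?m * x $ j \<le> d $ i + S + ?A * \<epsilon>"
    using row_inequality_bounds_entry[OF near[unfolded p] \<open>0 \<le> \<epsilon>\<close> row] by (simp add: S_def)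
  have median: "median3 (v $ j) (w $ j) \<beta> = max (v $ j) (min (w $ j) \<beta>)"
    by (rule median3_eq_clamp[OF vw(1)])
  have step: "tighten_step M d i j (v, w) = (let \<gamma> = max (v $ j) (min (w $ j) \<beta>) in
      if ?m > 0 then (v, \<chi> k. if k = j then \<gamma> else w $ k)
      else if ?m < 0 then (\<chi> k. if k = j then \<gamma> else v $ k, w) else (v, w))"
    unfolding tighten_step_def Let_def prod.case S_def[symmetric] \<beta>_def[symmetric] median ..
  consider "?m > 0" | "?m < 0" | "?m = 0" by linarith
  then have "near_box \<kappa> x (tighten_step M d i j (v, w))"
  proof cases
    case 1
    then have "x $ j \<le> (d $ i + S + ?A * \<epsilon>) / ?m"
      using bound by (simp add: pos_le_divide_eq mult.commute)
    also have "\<dots> = \<beta> + a"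
      using 1 by (simp add: \<beta>_def a_def add_divide_distrib)
    finally have "x $ j \<le> \<beta> + \<kappa>" using \<kappa>(2) by linarith
    then have "x $ j \<le> max (v $ j) (min (w $ j) \<beta>) + \<kappa>"
      using wide(2)[of j] by linarith
    then show ?thesis
      using 1 wide vw(1) by (auto simp: step near_box_def)
  next
    case 2
    then have "x $ j \<ge> (d $ i + S + ?A * \<epsilon>) / ?m"
      using bound by (simp add: neg_divide_le_eq mult.commute)
    moreover have "(d $ i + S + ?A * \<epsilon>) / ?m = \<beta> - a"
      using 2 by (simp add: \<beta>_def a_def add_divide_distrib)
    ultimately have "x $ j \<ge> \<beta> - \<kappa>" using \<kappa>(2) by linarith
    then have "x $ j \<ge> max (v $ j) (min (w $ j) \<beta>) - \<kappa>"
      using wide(1)[of j] by linarith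
    then show ?thesis
      using 2 wide vw(1) by (auto simp: step near_box_def)
  next
    case 3
    then show ?thesis using wide vw(1) by (auto simp: step near_box_def)
  qed
  then show ?thesis by (simp add: p \<kappa>_def)
qed

text \<open>
  The factor of a composition is the product of the factors. The constant parameter \<open>c\<close> is kept apart
  from the index \<open>a\<close> because the factor has to be uniform in \<open>c\<close>: below, \<open>c\<close> is the pair of the right-hand
  side \<open>d\<close> and the state \<open>x\<close>, which vary with time.
\<close>

lemma fold_amplifies_boundedly:
  fixes P :: "real \<Rightarrow> 'c \<Rightarrow> 's \<Rightarrow> bool" and f :: "'a \<Rightarrow> 'c \<Rightarrow> 's \<Rightarrow> 's"
  assumes step: "\<And>a. \<exists>K\<ge>0. \<forall>c \<epsilon> s. 0 \<le> \<epsilon> \<longrightarrow> P \<epsilon> c s \<longrightarrow> P (K * \<epsilon>) c (f a c s)"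
  shows "\<exists>K\<ge>0. \<forall>c \<epsilon> s. 0 \<le> \<epsilon> \<longrightarrow> P \<epsilon> c s \<longrightarrow> P (K * \<epsilon>) c (fold (\<lambda>a. f a c) as s)"
proof (induction as)
  case Nil
  show ?case by (intro exI[of _ 1]) simp
next
  case (Cons a as)
  obtain K where K: "0 \<le> K" "\<forall>c \<epsilon> s. 0 \<le> \<epsilon> \<longrightarrow> P \<epsilon> c s \<longrightarrow> P (K * \<epsilon>) c (fold (\<lambda>a. f a c) as s)"
    using Cons.IH by (elim exE conjE)
  obtain K' where K': "0 \<le> K'" "\<forall>c \<epsilon> s. 0 \<le> \<epsilon> \<longrightarrow> P \<epsilon> c s \<longrightarrow> P (K' * \<epsilon>) c (f a c s)"
    using step[of a] by (elim exE conjE)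
  have "P (K * K' * \<epsilon>) c (fold (\<lambda>a. f a c) (a # as) s)" if "0 \<le> \<epsilon>" "P \<epsilon> c s" for c \<epsilon> s
    using K(2)[rule_format, of "K' * \<epsilon>" c "f a c s"] K'(2)[rule_format, OF that] K'(1) that(1)
    by (simp add: mult.assoc)
  then show ?case
    using K(1) K'(1) by (intro exI[of _ "K * K'"]) auto
qed

lemma near_box_tighten_bounds:
  fixes M :: "real^'n::enum^'k::enum"
  shows "\<exists>K\<ge>0. \<forall>d x p \<epsilon>. 0 \<le> \<epsilon> \<longrightarrow> M *v x \<le> d \<longrightarrow> near_box \<epsilon> x p
           \<longrightarrow> near_box (K * \<epsilon>) x (tighten_bounds M d p)"
proof -
  define P :: "real \<Rightarrow> (real^'k::enum) \<times> (real^'n::enum) \<Rightarrow> (real^'n::enum) \<times> (real^'n::enum) \<Rightarrow> bool"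
    where "P \<epsilon> c p \<longleftrightarrow> M *v snd c \<le> fst c \<and> near_box \<epsilon> (snd c) p" for \<epsilon> c p
  have "\<exists>K\<ge>0. \<forall>c \<epsilon> p. 0 \<le> \<epsilon> \<longrightarrow> P \<epsilon> c p \<longrightarrow> P (K * \<epsilon>) c (tighten_step M (fst c) i j p)" for i j
    by (rule exI[of _ "1 + (\<Sum>k\<in>UNIV. \<bar>M $ i $ k\<bar>) / \<bar>M $ i $ j\<bar>"])
      (auto simp: P_def less_eq_vec_def sum_nonneg intro!: near_box_tighten_step)
  then have "\<exists>K\<ge>0. \<forall>c \<epsilon> p. 0 \<le> \<epsilon> \<longrightarrow> P \<epsilon> c p \<longrightarrow>
      P (K * \<epsilon>) c (fold (\<lambda>j. tighten_step M (fst c) i j) Enum.enum p)" for i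
    by (rule fold_amplifies_boundedly)
  then have "\<exists>K\<ge>0. \<forall>c \<epsilon> p. 0 \<le> \<epsilon> \<longrightarrow> P \<epsilon> c p \<longrightarrow>
      P (K * \<epsilon>) c (fold (\<lambda>i. fold (\<lambda>j. tighten_step M (fst c) i j) Enum.enum) Enum.enum p)"
    by (rule fold_amplifies_boundedly)
  then obtain K where "K \<ge> 0" and K: "\<forall>c \<epsilon> p. 0 \<le> \<epsilon> \<longrightarrow> P \<epsilon> c p \<longrightarrow>
      P (K * \<epsilon>) c (fold (\<lambda>i. fold (\<lambda>j. tighten_step M (fst c) i j) Enum.enum) Enum.enum p)"
    by (elim exE conjE)
  have "near_box (K * \<epsilon>) x (tighten_bounds M d p)" if "0 \<le> \<epsilon>" "M *v x \<le> d" "near_box \<epsilon> x p" for d x p \<epsilon>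
    using K[rule_format, of \<epsilon> "(d, x)" p] that by (simp add: P_def tighten_bounds_def)
  with \<open>K \<ge> 0\<close> show ?thesis by (intro exI[of _ K]) simp
qed

lemma near_box_imp_near_point:
  fixes x :: "real^'n"
  assumes "near_box \<epsilon> x (v, w)" "0 \<le> \<epsilon>"
  shows "\<exists>z\<in>{v..w}. norm (z - x) \<le> real CARD('n) * \<epsilon>"
proof
  define z where "z = (\<chi> j. max (v $ j) (min (w $ j) (x $ j)))"
  have vw: "v $ k \<le> w $ k" "v $ k - \<epsilon> \<le> x $ k" "x $ k \<le> w $ k + \<epsilon>" for k
    using assms(1) by (auto simp: near_box_def)
  show "z \<in> {v..w}"
    using vw(1) by (simp add: z_def less_eq_vec_def)
  have "norm (z - x) \<le> (\<Sum>j\<in>UNIV. \<bar>(z - x) $ j\<bar>)"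
    by (rule norm_le_l1_cart)
  also have "\<dots> \<le> (\<Sum>j\<in>(UNIV::'n set). \<epsilon>)"
  proof (rule sum_mono)
    fix j show "\<bar>(z - x) $ j\<bar> \<le> \<epsilon>"
      using vw[of j] \<open>0 \<le> \<epsilon>\<close> unfolding z_def by (simp add: max_def min_def abs_le_iff)
  qed
  finally show "norm (z - x) \<le> real CARD('n) * \<epsilon>" by simp
qed

text \<open>
  The rows of the stacked system say \<open>vL \<le> y - C *v x \<le> vU\<close>, which a state consistent with the measurement
  satisfies. The factor \<open>K\<close> depends on \<open>C\<close> alone, so it is the same at all times.
\<close>

lemma measurement_tightening_keeps_near_point:
  fixes C :: "real^'n::enum^'m::enum"
  shows "\<exists>K\<ge>0. \<forall>vL vU t x v lo hi \<epsilon>. 0 \<le> \<epsilon> \<longrightarrow> v \<in> {vL t..vU t} \<longrightarrow> near_box \<epsilon> x (lo, hi)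
           \<longrightarrow> (\<exists>z\<in>measurement_tightening C vL vU {lo..hi} t (C *v x + v). norm (z - x) \<le> K * \<epsilon>)"
proof -
  define M :: "real^'n::enum^('m::enum + 'm::enum)" where "M = (\<chi> r. case r of Inl i \<Rightarrow> C $ i | Inr i \<Rightarrow> - C $ i)"
  obtain K where K: "0 \<le> K" "\<forall>d x p \<epsilon>. 0 \<le> \<epsilon> \<longrightarrow> M *v x \<le> d \<longrightarrow> near_box \<epsilon> x p
           \<longrightarrow> near_box (K * \<epsilon>) x (tighten_bounds M d p)"
    using near_box_tighten_bounds[of M] by (elim exE conjE)
  have "\<exists>z\<in>measurement_tightening C vL vU {lo..hi} t (C *v x + v). norm (z - x) \<le> real CARD('n) * K * \<epsilon>"
    if \<epsilon>: "0 \<le> \<epsilon>" and v: "v \<in> {vL t..vU t}" and near: "near_box \<epsilon> x (lo, hi)" for vL vU t x v lo hi \<epsilon>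
  proof -
    define d :: "real^('m::enum + 'm::enum)" where
      "d = (\<chi> r. case r of Inl i \<Rightarrow> (C *v x + v - vL t) $ i | Inr i \<Rightarrow> (- (C *v x + v) + vU t) $ i)"
    have "M *v x \<le> d"
      unfolding less_eq_vec_def
    proof
      fix r show "(M *v x) $ r \<le> d $ r"
      proof (cases r)
        case (Inl i)
        then show ?thesis using v by (simp add: M_def d_def matrix_vector_mult_def less_eq_vec_def)
      next
        case (Inr i)
        then show ?thesis using v by (simp add: M_def d_def matrix_vector_mult_def less_eq_vec_def sum_negf)
      qed
    qed
    then have "near_box (K * \<epsilon>) x (tighten_bounds M d (lo, hi))"
      using K(2) \<epsilon> near by simp
    moreover have "lo \<le> hi"
      using near by (simp add: near_box_def less_eq_vec_def)
    then have "measurement_tightening C vL vU {lo..hi} t (C *v x + v)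
        = (case tighten_bounds M d (lo, hi) of (v', w') \<Rightarrow> {v'..w'})"
      unfolding measurement_tightening_def M_def d_def by (rule interval_tightening_interval)
    ultimately show ?thesis
      using near_box_imp_near_point[of "K * \<epsilon>" x] K(1) \<epsilon>
      by (cases "tighten_bounds M d (lo, hi)") (simp add: mult.assoc)
  qed
  then show ?thesis
    using K(1) by (intro exI[of _ "real CARD('n) * K"]) simp
qed

text \<open>
  If \<open>v $ i \<le> w $ i\<close>, the face lies at \<open>v $ i\<close>, which is between \<open>x $ i\<close> and \<open>x $ i + \<epsilon>\<close>. If the bounds
  have crossed, it lies at their mean, and \<open>x $ i\<close> is within \<open>\<epsilon>\<close> of the mean because it is at least
  \<open>v $ i - \<epsilon>\<close> and at most \<open>w $ i + \<epsilon>\<close>.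
\<close>

lemma near_box_face_L:
  assumes out: "x $ i \<le> v $ i" and "\<And>j. v $ j - \<epsilon> \<le> x $ j" "\<And>j. x $ j \<le> w $ j + \<epsilon>" and "0 \<le> \<epsilon>"
  obtains lo hi where "face_L i v w = {lo..hi}" "near_box \<epsilon> x (lo, hi)"
proof
  define hi where "hi = (\<chi> k. if k = i then lo_hat v w $ i else hi_hat v w $ k)"
  have ordered: "lo_hat v w $ k \<le> hi_hat v w $ k" for k
    by (simp add: lo_hat_def hi_hat_def min_def max_def field_simps)
  show "face_L i v w = {lo_hat v w..hi}"
  proof (intro equalityI subsetI)
    fix z assume "z \<in> face_L i v w"
    then show "z \<in> {lo_hat v w..hi}"
      by (auto simp: face_L_def hi_def less_eq_vec_def)
  next
    fix z assume z: "z \<in> {lo_hat v w..hi}"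
    then have between: "lo_hat v w $ k \<le> z $ k" "z $ k \<le> hi $ k" for k
      by (auto simp: less_eq_vec_def)
    have "z $ i = lo_hat v w $ i"
      using between[of i] by (simp add: hi_def)
    moreover have "lo_hat v w $ k \<le> z $ k \<and> z $ k \<le> hi_hat v w $ k" for k
      using between[of k] ordered[of k] by (cases "k = i") (auto simp: hi_def)
    ultimately show "z \<in> face_L i v w"
      by (simp add: face_L_def less_eq_vec_def)
  qed
  show "near_box \<epsilon> x (lo_hat v w, hi)"
    unfolding near_box_def prod.case
  proof (intro allI)
    fix j show "lo_hat v w $ j \<le> hi $ j \<and> lo_hat v w $ j - \<epsilon> \<le> x $ j \<and> x $ j \<le> hi $ j + \<epsilon>"
      using assms(2)[of j] assms(3)[of j] out \<open>0 \<le> \<epsilon>\<close>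
      by (cases "j = i") (simp_all add: hi_def lo_hat_def hi_hat_def min_def max_def field_simps)
  qed
qed

lemma near_box_face_U:
  assumes out: "w $ i \<le> x $ i" and "\<And>j. v $ j - \<epsilon> \<le> x $ j" "\<And>j. x $ j \<le> w $ j + \<epsilon>" and "0 \<le> \<epsilon>"
  obtains lo hi where "face_U i v w = {lo..hi}" "near_box \<epsilon> x (lo, hi)"
proof
  define lo where "lo = (\<chi> k. if k = i then hi_hat v w $ i else lo_hat v w $ k)"
  have ordered: "lo_hat v w $ k \<le> hi_hat v w $ k" for k
    by (simp add: lo_hat_def hi_hat_def min_def max_def field_simps)
  show "face_U i v w = {lo..hi_hat v w}"
  proof (intro equalityI subsetI)
    fix z assume "z \<in> face_U i v w"
    then show "z \<in> {lo..hi_hat v w}"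
      by (auto simp: face_U_def lo_def less_eq_vec_def)
  next
    fix z assume z: "z \<in> {lo..hi_hat v w}"
    then have between: "lo $ k \<le> z $ k" "z $ k \<le> hi_hat v w $ k" for k
      by (auto simp: less_eq_vec_def)
    have "z $ i = hi_hat v w $ i"
      using between[of i] by (simp add: lo_def)
    moreover have "lo_hat v w $ k \<le> z $ k \<and> z $ k \<le> hi_hat v w $ k" for k
      using between[of k] ordered[of k] by (cases "k = i") (auto simp: lo_def)
    ultimately show "z \<in> face_U i v w"
      by (simp add: face_U_def less_eq_vec_def)
  qed
  show "near_box \<epsilon> x (lo, hi_hat v w)"
    unfolding near_box_def prod.case
  proof (intro allI)
    fix j show "lo $ j \<le> hi_hat v w $ j \<and> lo $ j - \<epsilon> \<le> x $ j \<and> x $ j \<le> hi_hat v w $ j + \<epsilon>"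
      using assms(2)[of j] assms(3)[of j] out \<open>0 \<le> \<epsilon>\<close>
      by (cases "j = i") (simp_all add: lo_def lo_hat_def hi_hat_def min_def max_def field_simps)
  qed
qed

section \<open>Inclusion functions and measurement feedback\<close>

lemma singleton_in_compact_intervals: "a \<in> A \<Longrightarrow> {a} \<in> compact_intervals A"
  unfolding compact_intervals_def by (auto intro!: exI[of _ a])

lemma value_in_inclusion_monotonic_extension:
  assumes ext: "inclusion_monotonic_extension T Du Dx Dv g G"
    and U': "U' \<in> compact_intervals Du" "u \<in> U'" and Z': "Z' \<in> compact_intervals Dx" "z \<in> Z'"
    and V': "V' \<in> compact_intervals Dv" "v \<in> V'" and t: "t \<in> T"
  shows "g t u z v \<in> G {t} U' Z' V'"
proof -
  have mem: "u \<in> Du" "z \<in> Dx" "v \<in> Dv"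
    using U' Z' V' unfolding compact_intervals_def by auto
  have "G {t} {u} {z} {v} \<subseteq> G {t} U' Z' V'"
    using ext[unfolded inclusion_monotonic_extension_def, THEN conjunct2, THEN conjunct2, rule_format,
        of "{t}" "{t}" "{u}" U' "{z}" Z' "{v}" V']
      t mem U' Z' V' by (simp add: singleton_in_compact_intervals)
  moreover have "G {t} {u} {z} {v} = {g t u z v}"
    using ext mem t unfolding inclusion_monotonic_extension_def by blast
  ultimately show ?thesis by simp
qed

text \<open>
  With the output \<open>C *v x + v\<close> fed back, \<open>fhat\<close> at \<open>x\<close> becomes \<open>f\<close> at \<open>x\<close>; at another point \<open>z\<close>
  the matrix \<open>L\<close> acts only on \<open>C *v (z - x)\<close>.
\<close>

lemma innovation_deviation:
  fixes C :: "real^'n^'m" and L :: "real^'m^'n"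
  shows "\<bar>fhat f C L t u z v $ i + (L *v (C *v x + v)) $ i - f t u x $ i\<bar>
    \<le> norm (f t u z - f t u x) + onorm ((*v) (L ** C)) * norm (z - x)"
proof -
  have "fhat f C L t u z v + L *v (C *v x + v) - f t u x = (f t u z - f t u x) - (L ** C) *v (z - x)"
    by (simp add: fhat_def matrix_vector_right_distrib matrix_vector_mult_diff_distrib matrix_vector_mul_assoc)
  then have "\<bar>fhat f C L t u z v $ i + (L *v (C *v x + v)) $ i - f t u x $ i\<bar>
      \<le> norm ((f t u z - f t u x) - (L ** C) *v (z - x))"
    by (metis component_le_norm_cart vector_add_component vector_minus_component)
  also have "\<dots> \<le> norm (f t u z - f t u x) + norm ((L ** C) *v (z - x))"
    by (rule norm_triangle_ineq4)
  also have "norm ((L ** C) *v (z - x)) \<le> onorm ((*v) (L ** C)) * norm (z - x)"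
    by (rule onorm[OF matrix_vector_mul_bounded_linear])
  finally show ?thesis by simp
qed

section \<open>State bounds\<close>

lemma AE_lebesgue_on_obtain_negligible:
  assumes "S \<in> sets lebesgue" "AE t in lebesgue_on S. P t"
  obtains N where "negligible N" "\<And>t. t \<in> S - N \<Longrightarrow> P t"
proof -
  have "AE t in lebesgue. t \<in> S \<longrightarrow> P t"
    using assms by (subst (asm) AE_restrict_space_iff) auto
  then obtain N where "N \<in> null_sets lebesgue" "{t \<in> space lebesgue. \<not> (t \<in> S \<longrightarrow> P t)} \<subseteq> N"
    unfolding eventually_ae_filter by blast
  then show thesis
    using that[of N] by (auto simp: negligible_iff_null_sets)
qed

theorem theorem1:
  fixes t0 tf :: real and T :: "real set"
    and Dx :: "(real^'n::enum) set" and Du :: "(real^'p) set"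
    and f :: "real \<Rightarrow> real^'p \<Rightarrow> real^'n::enum \<Rightarrow> real^'n::enum"
    and C :: "real^'n::enum^'m::enum" and L :: "real^'m::enum^'n::enum"
    and X0 :: "(real^'n::enum) set"
    and U :: "real \<Rightarrow> (real^'p) set" and uL uU :: "real \<Rightarrow> real^'p"
    and V :: "real \<Rightarrow> (real^'m::enum) set" and vL vU :: "real \<Rightarrow> real^'m::enum"
    and fL fU :: "real set \<Rightarrow> (real^'p) set \<Rightarrow> (real^'n::enum) set \<Rightarrow> (real^'m::enum) set \<Rightarrow> real^'n::enum"
    and y :: "real \<Rightarrow> real^'m::enum" and xL xU :: "real \<Rightarrow> real^'n::enum"
  defines "Ic \<equiv> measurement_tightening C vL vU"
  assumes T: "t0 \<le> tf" "T = {t0..tf}"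
    and X0: "X0 \<in> compact_intervals Dx"
    and V: "\<forall>t\<in>T. V t = {vL t..vU t} \<and> V t \<in> compact_intervals UNIV"
    and U: "\<forall>t\<in>T. U t = {uL t..uU t} \<and> U t \<in> compact_intervals Du"
    and V_compact: "\<exists>Kv. compact Kv \<and> (\<forall>t\<in>T. V t \<subseteq> Kv)"
    and U_compact: "\<exists>Ku. compact Ku \<and> (\<forall>t\<in>T. U t \<subseteq> Ku)"
    and f_Lipschitz: "locally_Lipschitz_L1 T U Dx f"
    and extension: "inclusion_monotonic_extension T Du Dx UNIV (fhat f C L)
                      (\<lambda>T' U' Z' V'. {fL T' U' Z' V'..fU T' U' Z' V'})"
    and xL_ac: "absolutely_continuous_on T xL" and xU_ac: "absolutely_continuous_on T xU"
    and init: "{xL t0..xU t0} = X0"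
    and xL_deriv: "\<And>i. AE t in lebesgue_on T.
          Ic (face_L i (xL t) (xU t)) t (y t) \<in> compact_intervals Dx \<and>
          ((\<lambda>s. xL s $ i) has_real_derivative
             fL {t..t} (U t) (Ic (face_L i (xL t) (xU t)) t (y t)) (V t) $ i + (L *v y t) $ i)
            (at t within T)"
    and xU_deriv: "\<And>i. AE t in lebesgue_on T.
          Ic (face_U i (xL t) (xU t)) t (y t) \<in> compact_intervals Dx \<and>
          ((\<lambda>s. xU s $ i) has_real_derivative
             fU {t..t} (U t) (Ic (face_U i (xL t) (xU t)) t (y t)) (V t) $ i + (L *v y t) $ i)
            (at t within T)"
  shows "\<forall>x :: real \<Rightarrow> real^'n::enum.
           absolutely_continuous_on T x \<and> (\<forall>t\<in>T. x t \<in> Dx) \<and>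
           (\<exists>u v. u \<in> borel_measurable (lebesgue_on T) \<and> v \<in> borel_measurable (lebesgue_on T) \<and>
              (\<forall>t\<in>T. u t \<in> U t) \<and> (\<forall>t\<in>T. v t \<in> V t) \<and>
              x t0 \<in> X0 \<and>
              (AE t in lebesgue_on T. (x has_vector_derivative f t (u t) (x t)) (at t within T)) \<and>
              (\<forall>t\<in>T. y t = C *v x t + v t))
           \<longrightarrow> (\<forall>t\<in>T. x t \<in> {xL t..xU t})"
proof (intro allI impI, elim conjE exE, intro ballI)
  fix x u v r
  assume x_ac: "absolutely_continuous_on T x" and xD: "\<forall>t\<in>T. x t \<in> Dx"
    and u: "\<forall>t\<in>T. u t \<in> U t" and v: "\<forall>t\<in>T. v t \<in> V t" and x0: "x t0 \<in> X0"
    and x_deriv: "AE t in lebesgue_on T. (x has_vector_derivative f t (u t) (x t)) (at t within T)"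
    and y: "\<forall>t\<in>T. y t = C *v x t + v t" and r: "r \<in> T"
  define \<phi> where "\<phi> k t = (case k of Inl i \<Rightarrow> xL t $ i - x t $ i | Inr i \<Rightarrow> x t $ i - xU t $ i)"
    for k :: "'n + 'n" and t
  define \<delta> where "\<delta> t = (\<Sum>k\<in>UNIV. max 0 (\<phi> k t))" for t
  have \<delta>_nonneg: "0 \<le> \<delta> t" for t
    by (simp add: \<delta>_def sum_nonneg)
  have \<phi>_le_\<delta>: "\<phi> k t \<le> \<delta> t" for k t
    using member_le_sum[of k UNIV "\<lambda>k. max 0 (\<phi> k t)"] by (simp add: \<delta>_def)
  have near: "xL t $ j - \<delta> t \<le> x t $ j" "x t $ j \<le> xU t $ j + \<delta> t" for t j
    using \<phi>_le_\<delta>[of "Inl j" t] \<phi>_le_\<delta>[of "Inr j" t] by (auto simp: \<phi>_def)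
  have \<phi>_ac: "absolutely_continuous_on T (\<phi> k)" for k
    by (cases k) (auto simp: \<phi>_def[abs_def] intro!: absolutely_continuous_on_diff
        absolutely_continuous_on_component xL_ac xU_ac x_ac)
  obtain K where "K \<ge> 0" and K: "\<forall>vL vU t x v lo hi \<epsilon>. 0 \<le> \<epsilon> \<longrightarrow> v \<in> {vL t..vU t}
      \<longrightarrow> near_box \<epsilon> x (lo, hi)
      \<longrightarrow> (\<exists>z\<in>measurement_tightening C vL vU {lo..hi} t (C *v x + v). norm (z - x) \<le> K * \<epsilon>)"
    using measurement_tightening_keeps_near_point[of C] by (elim exE conjE)
  have tightened: "\<exists>z\<in>Ic {lo..hi} t (y t). norm (z - x t) \<le> K * \<delta> t"
    if "t \<in> T" "near_box (\<delta> t) (x t) (lo, hi)" for t lo hi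
    using K[rule_format, OF \<delta>_nonneg _ that(2), of "v t" vL t vU] that(1) y v V
    by (auto simp: Ic_def)
  define B where "B = onorm ((*v) (L ** C))"
  have "B \<ge> 0"
    unfolding B_def by (intro onorm_pos_le matrix_vector_mul_bounded_linear)
  have enclosed: "fhat f C L t (u t) z (v t) \<in> {fL {t} (U t) Z (V t)..fU {t} (U t) Z (V t)}"
    if "t \<in> T" "Z \<in> compact_intervals Dx" "z \<in> Z" for t z Z
    by (rule value_in_inclusion_monotonic_extension[OF extension]) (use U u V v that in blast)+

  \<comment> \<open>When \<open>x $ i\<close> is below \<open>xL $ i\<close>, the lower bound outruns it at a rate no larger than the change of
    \<open>f\<close> and of the linear feedback between \<open>x\<close> and some point of the tightened face.\<close>
  have lower_rate: "\<exists>z\<in>Z. norm (z - x t) \<le> K * \<delta> t \<and>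
      fL {t..t} (U t) Z (V t) $ i + (L *v y t) $ i - f t (u t) (x t) $ i
        \<le> norm (f t (u t) z - f t (u t) (x t)) + B * norm (z - x t)"
    if prems: "t \<in> T" "\<phi> (Inl i) t > 0" "Z = Ic (face_L i (xL t) (xU t)) t (y t)" "Z \<in> compact_intervals Dx" for t i Z
  proof -
    have "x t $ i \<le> xL t $ i" using prems(2) by (simp add: \<phi>_def)
    from near_box_face_L[OF this near \<delta>_nonneg] obtain lo hi where
      "face_L i (xL t) (xU t) = {lo..hi}" "near_box (\<delta> t) (x t) (lo, hi)" by blast
    then obtain z where z: "z \<in> Z" "norm (z - x t) \<le> K * \<delta> t"
      using tightened prems(1,3) by metis
    have "fL {t} (U t) Z (V t) $ i \<le> fhat f C L t (u t) z (v t) $ i"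
      using enclosed[OF prems(1,4) z(1)] by (auto simp: less_eq_vec_def)
    moreover have "\<bar>fhat f C L t (u t) z (v t) $ i + (L *v y t) $ i - f t (u t) (x t) $ i\<bar>
        \<le> norm (f t (u t) z - f t (u t) (x t)) + B * norm (z - x t)"
      unfolding B_def using innovation_deviation[of f C L t "u t" z "v t" i "x t"] y prems(1) by simp
    ultimately show ?thesis
      using z by (intro bexI[of _ z]) auto
  qed
  have upper_rate: "\<exists>z\<in>Z. norm (z - x t) \<le> K * \<delta> t \<and>
      f t (u t) (x t) $ i - (fU {t..t} (U t) Z (V t) $ i + (L *v y t) $ i)
        \<le> norm (f t (u t) z - f t (u t) (x t)) + B * norm (z - x t)"
    if prems: "t \<in> T" "\<phi> (Inr i) t > 0" "Z = Ic (face_U i (xL t) (xU t)) t (y t)" "Z \<in> compact_intervals Dx" for t i Z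
  proof -
    have "xU t $ i \<le> x t $ i" using prems(2) by (simp add: \<phi>_def)
    from near_box_face_U[OF this near \<delta>_nonneg] obtain lo hi where
      "face_U i (xL t) (xU t) = {lo..hi}" "near_box (\<delta> t) (x t) (lo, hi)" by blast
    then obtain z where z: "z \<in> Z" "norm (z - x t) \<le> K * \<delta> t"
      using tightened prems(1,3) by metis
    have "fhat f C L t (u t) z (v t) $ i \<le> fU {t} (U t) Z (V t) $ i"
      using enclosed[OF prems(1,4) z(1)] by (auto simp: less_eq_vec_def)
    moreover have "\<bar>fhat f C L t (u t) z (v t) $ i + (L *v y t) $ i - f t (u t) (x t) $ i\<bar>
        \<le> norm (f t (u t) z - f t (u t) (x t)) + B * norm (z - x t)"
      unfolding B_def using innovation_deviation[of f C L t "u t" z "v t" i "x t"] y prems(1) by simp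
    ultimately show ?thesis
      using z by (intro bexI[of _ z]) auto
  qed

  have "AE t in lebesgue_on T. (x has_vector_derivative f t (u t) (x t)) (at t within T) \<and>
      (\<forall>i. Ic (face_L i (xL t) (xU t)) t (y t) \<in> compact_intervals Dx \<and>
          ((\<lambda>s. xL s $ i) has_real_derivative
             fL {t..t} (U t) (Ic (face_L i (xL t) (xU t)) t (y t)) (V t) $ i + (L *v y t) $ i)
            (at t within T)) \<and>
      (\<forall>i. Ic (face_U i (xL t) (xU t)) t (y t) \<in> compact_intervals Dx \<and>
          ((\<lambda>s. xU s $ i) has_real_derivative
             fU {t..t} (U t) (Ic (face_U i (xL t) (xU t)) t (y t)) (V t) $ i + (L *v y t) $ i)
            (at t within T))"
    by (intro eventually_conj eventually_all_finite x_deriv allI xL_deriv xU_deriv)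
  then obtain N1 where N1: "negligible N1" and regular: "\<And>t. t \<in> T - N1 \<Longrightarrow>
      (x has_vector_derivative f t (u t) (x t)) (at t within T) \<and>
      (\<forall>i. Ic (face_L i (xL t) (xU t)) t (y t) \<in> compact_intervals Dx \<and>
          ((\<lambda>s. xL s $ i) has_real_derivative
             fL {t..t} (U t) (Ic (face_L i (xL t) (xU t)) t (y t)) (V t) $ i + (L *v y t) $ i)
            (at t within T)) \<and>
      (\<forall>i. Ic (face_U i (xL t) (xU t)) t (y t) \<in> compact_intervals Dx \<and>
          ((\<lambda>s. xU s $ i) has_real_derivative
             fU {t..t} (U t) (Ic (face_U i (xL t) (xU t)) t (y t)) (V t) $ i + (L *v y t) $ i)
            (at t within T))"
    by (rule AE_lebesgue_on_obtain_negligible[rotated]) (use T(2) in auto)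

  have "\<phi> k r \<le> 0" for k
  proof (rule positive_parts_vanish[where \<phi> = \<phi> and a = t0 and b = tf])
    show "absolutely_continuous_on {t0..tf} (\<phi> k)" for k
      using \<phi>_ac T(2) by simp
    show "\<phi> k t0 \<le> 0" for k
      using x0 unfolding init[symmetric] by (cases k) (auto simp: \<phi>_def less_eq_vec_def)
    show "r \<in> {t0..tf}" using r T(2) by simp
    fix s assume s: "t0 \<le> s" "s < tf" "\<And>k. \<phi> k s \<le> 0"
    then have "s \<in> T" and "\<delta> s = 0"
      using T(2) by (auto simp: \<delta>_def intro!: sum.neutral)
    obtain \<rho> \<alpha> where "\<rho> > 0" and \<alpha>: "integrable (lebesgue_on T) \<alpha>" and
      "AE t in lebesgue_on T. \<forall>w\<in>U t. \<forall>z1\<in>ball (x s) \<rho> \<inter> Dx. \<forall>z2\<in>ball (x s) \<rho> \<inter> Dx.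
        norm (f t w z1 - f t w z2) \<le> \<alpha> t * norm (z1 - z2)"
      using f_Lipschitz xD \<open>s \<in> T\<close> unfolding locally_Lipschitz_L1_def by meson
    then obtain N2 where N2: "negligible N2" and Lipschitz: "\<And>t. t \<in> T - N2 \<Longrightarrow>
        \<forall>w\<in>U t. \<forall>z1\<in>ball (x s) \<rho> \<inter> Dx. \<forall>z2\<in>ball (x s) \<rho> \<inter> Dx.
        norm (f t w z1 - f t w z2) \<le> \<alpha> t * norm (z1 - z2)"
      using AE_lebesgue_on_obtain_negligible T(2) by (metis (no_types, lifting) lmeasurable_cbox box_real(2) fmeasurableD)
    \<comment> \<open>Small \<open>\<omega>\<close> keeps both \<open>x t\<close> and every point within \<open>K * \<delta> t\<close> of it in the Lipschitz ball.\<close>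
    define \<omega> where "\<omega> t = norm (x t - x s) + K * \<delta> t" for t
    have "continuous_on T \<omega>"
      unfolding \<omega>_def \<delta>_def T(2)
      by (intro continuous_intros absolutely_continuous_on_imp_continuous_on \<phi>_ac[unfolded T(2)] x_ac[unfolded T(2)])
    moreover have "\<omega> s = 0"
      using \<open>\<delta> s = 0\<close> by (simp add: \<omega>_def)
    ultimately obtain d where "d > 0" and d: "\<And>t. t \<in> T \<Longrightarrow> \<bar>t - s\<bar> < d \<Longrightarrow> \<bar>\<omega> t\<bar> < \<rho>"
      using \<open>s \<in> T\<close> \<open>\<rho> > 0\<close> unfolding continuous_on_iff dist_real_def by (metis diff_zero)
    define e where "e = min tf (s + d / 2)"
    have e: "s < e" "e \<le> tf" "e - s < d"
      using s(2) \<open>d > 0\<close> by (auto simp: e_def)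
    have sub: "{s..e} \<subseteq> T"
      using s(1) e(2) T(2) by auto
    have close: "norm (x t - x s) + K * \<delta> t < \<rho>" if "t \<in> {s..e}" for t
    proof -
      have "\<bar>t - s\<bar> < d" "t \<in> T" using that e sub by auto
      then show ?thesis using d[of t] by (simp add: \<omega>_def)
    qed
    \<comment> \<open>The absolute value makes \<open>\<beta>\<close> nonnegative also at times when \<open>\<alpha>\<close> is negative.\<close>
    define \<beta> where "\<beta> t = (\<bar>\<alpha> t\<bar> + B) * K" for t
    have "(\<lambda>t. \<bar>\<alpha> t\<bar>) integrable_on T"
      using integrable_on_lebesgue_on[OF integrable_abs[OF \<alpha>]] T(2) by simp
    then have "\<beta> integrable_on T"
      unfolding \<beta>_def T(2) by (intro integrable_on_mult_left integrable_add integrable_const_ivl)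
    then have \<beta>: "\<beta> integrable_on {s..e}"
      using sub integrable_on_subinterval by blast
    have "\<exists>D \<le> \<beta> t * \<delta> t. (\<phi> k has_real_derivative D) (at t within {s..e})"
      if t: "t \<in> {s..e} - (N1 \<union> N2)" and pos: "\<phi> k t > 0" for k t
    proof -
      have tT: "t \<in> T" "t \<in> T - N1" "t \<in> T - N2" and te: "t \<in> {s..e}" using t sub by auto
      have growth: "norm (f t (u t) z - f t (u t) (x t)) + B * norm (z - x t) \<le> \<beta> t * \<delta> t"
        if "z \<in> Dx" and z: "norm (z - x t) \<le> K * \<delta> t" for z
      proof -
        have "norm (x t - x s) < \<rho>"
          using close[OF te] mult_nonneg_nonneg[OF \<open>K \<ge> 0\<close> \<delta>_nonneg[of t]] by linarith
        moreover have "norm (z - x s) \<le> norm (x t - x s) + norm (z - x t)"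
          using norm_triangle_ineq[of "x t - x s" "z - x t"] by simp
        then have "norm (z - x s) < \<rho>"
          using close[OF te] z by linarith
        ultimately have "norm (f t (u t) z - f t (u t) (x t)) \<le> \<alpha> t * norm (z - x t)"
          using Lipschitz[OF tT(3)] u xD tT(1) \<open>z \<in> Dx\<close> by (simp add: dist_norm norm_minus_commute)
        also have "\<dots> \<le> \<bar>\<alpha> t\<bar> * norm (z - x t)"
          by (intro mult_right_mono) auto
        finally have "norm (f t (u t) z - f t (u t) (x t)) + B * norm (z - x t) \<le> (\<bar>\<alpha> t\<bar> + B) * norm (z - x t)"
          by (simp add: distrib_right)
        also have "\<dots> \<le> (\<bar>\<alpha> t\<bar> + B) * (K * \<delta> t)"
          using z \<open>B \<ge> 0\<close> by (intro mult_left_mono) auto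
        finally show ?thesis by (simp add: \<beta>_def mult.assoc)
      qed
      have x_comp: "((\<lambda>s. x s $ i) has_real_derivative f t (u t) (x t) $ i) (at t within T)" for i
        using regular[OF tT(2)] bounded_linear.has_vector_derivative[OF bounded_linear_vec_nth]
        by (auto simp: has_real_derivative_iff_has_vector_derivative)
      show ?thesis
      proof (cases k)
        case (Inl i)
        define Z where "Z = Ic (face_L i (xL t) (xU t)) t (y t)"
        have Z: "Z \<in> compact_intervals Dx" and "((\<lambda>s. xL s $ i) has_real_derivative
             fL {t..t} (U t) Z (V t) $ i + (L *v y t) $ i) (at t within T)"
          using regular[OF tT(2)] by (auto simp: Z_def)
        then have "(\<phi> k has_real_derivative
             fL {t..t} (U t) Z (V t) $ i + (L *v y t) $ i - f t (u t) (x t) $ i) (at t within {s..e})"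
          unfolding Inl \<phi>_def[abs_def] sum.case
          by (intro DERIV_subset[OF _ sub] DERIV_diff x_comp)
        moreover obtain z where "z \<in> Z" "norm (z - x t) \<le> K * \<delta> t" and
          "fL {t..t} (U t) Z (V t) $ i + (L *v y t) $ i - f t (u t) (x t) $ i
            \<le> norm (f t (u t) z - f t (u t) (x t)) + B * norm (z - x t)"
          using lower_rate[OF tT(1) pos[unfolded Inl] Z_def Z] by blast
        moreover have "z \<in> Dx"
          using Z \<open>z \<in> Z\<close> by (auto simp: compact_intervals_def)
        ultimately show ?thesis
          using growth order_trans by meson
      next
        case (Inr i)
        define Z where "Z = Ic (face_U i (xL t) (xU t)) t (y t)"
        have Z: "Z \<in> compact_intervals Dx" and "((\<lambda>s. xU s $ i) has_real_derivative
             fU {t..t} (U t) Z (V t) $ i + (L *v y t) $ i) (at t within T)"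
          using regular[OF tT(2)] by (auto simp: Z_def)
        then have "(\<phi> k has_real_derivative
             f t (u t) (x t) $ i - (fU {t..t} (U t) Z (V t) $ i + (L *v y t) $ i)) (at t within {s..e})"
          unfolding Inr \<phi>_def[abs_def] sum.case
          by (intro DERIV_subset[OF _ sub] DERIV_diff x_comp)
        moreover obtain z where "z \<in> Z" "norm (z - x t) \<le> K * \<delta> t" and
          "f t (u t) (x t) $ i - (fU {t..t} (U t) Z (V t) $ i + (L *v y t) $ i)
            \<le> norm (f t (u t) z - f t (u t) (x t)) + B * norm (z - x t)"
          using upper_rate[OF tT(1) pos[unfolded Inr] Z_def Z] by blast
        moreover have "z \<in> Dx"
          using Z \<open>z \<in> Z\<close> by (auto simp: compact_intervals_def)
        ultimately show ?thesis
          using growth order_trans by meson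
      qed
    qed
    then show "\<exists>e \<beta> N. s < e \<and> e \<le> tf \<and> \<beta> integrable_on {s..e} \<and> (\<forall>t\<in>{s..e}. 0 \<le> \<beta> t) \<and> negligible N \<and>
        (\<forall>k. \<forall>t\<in>{s..e} - N. \<phi> k t > 0 \<longrightarrow>
          (\<exists>D \<le> \<beta> t * (\<Sum>k\<in>UNIV. max 0 (\<phi> k t)). (\<phi> k has_real_derivative D) (at t within {s..e})))"
      using e(1,2) \<beta> N1 N2 \<open>B \<ge> 0\<close> \<open>K \<ge> 0\<close> unfolding \<delta>_def[symmetric]
      by (intro exI[of _ e] exI[of _ \<beta>] exI[of _ "N1 \<union> N2"]) (auto simp: \<beta>_def)
  qed
  from this[of "Inl _"] this[of "Inr _"] show "x r \<in> {xL r..xU r}"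
    by (auto simp: \<phi>_def less_eq_vec_def)
qed

end
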